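(* Let $\mathbf{k}[\partial]A$ and $\mathbf{k}[\partial]B$ be the Lie conformal algebras corresponding to Gel'fand-Dorfman algebras $(A,\circ_A,[\cdot,\cdot]_A)$ and $(B,\circ_B,[\cdot,\cdot]_B)$ respectively. Let $l_A,r_A,\rho_A:A\to\mathrm{End}_{\mathbf{k}}(B)$ and $l_B,r_B,\rho_B:B\to\mathrm{End}_{\mathbf{k}}(A)$ be linear maps. Then $(\mathbf{k}[\partial]A,\mathbf{k}[\partial]B,\rho_{l_A,r_A,\rho_A},\rho_{l_B,r_B,\rho_B})$ is a matched pair of Lie conformal algebras if and only if $(A,B,l_A,r_A,\rho_A,l_B,r_B,\rho_B)$ is a matched pair of Gel'fand-Dorfman algebras.
   Context: Conventions: $\mathbf{k}$ is a field of characteristic $0$; vector spaces over $\mathbf{k}$ are finite-dimensional; $a\star b=a\circ b+b\circ a$; $\mathbf{k}[\partial]A=\mathbf{k}[\partial]\otimes_{\mathbf{k}}A$ is the free module on $A$. A Novikov algebra $(A,\circ)$ satisfies $(a\circ b)\circ c-a\circ(b\circ c)=(b\circ a)\circ c-b\circ(a\circ c)$ and $(a\circ b)\circ c=(a\circ c)\circ b$. A Gel'fand-Dorfman (GD) algebra $(A,\circ,[\cdot,\cdot])$ is a Novikov algebra $(A,\circ)$ and a Lie algebra $(A,[\cdot,\cdot])$ with $[a\circ b,c]-[a\circ c,b]+[a,b]\circ c-[a,c]\circ b-a\circ[b,c]=0$ for all $a,b,c$. The octuple $(A,B,l_A,r_A,\rho_A,l_B,r_B,\rho_B)$ is a matched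 pair of GD algebras if $A\oplus B$ is a GD algebra under $(a+x)\bullet(b+y)=(a\circ_A b+l_B(x)b+r_B(y)a)+(x\circ_B y+l_A(a)y+r_A(b)x)$, $[a+x,b+y]=([a,b]_A+\rho_B(x)b-\rho_B(y)a)+([x,y]_B+\rho_A(a)y-\rho_A(b)x)$, for $a,b\in A$, $x,y\in B$. A Lie conformal algebra is a $\mathbf{k}[\partial]$-module $R$ with a $\mathbf{k}$-bilinear map $[\cdot_\lambda\cdot]:R\times R\to R[\lambda]$ such that $[\partial a_\lambda b]=-\lambda[a_\lambda b]$, $[a_\lambda\partial b]=(\lambda+\partial)[a_\lambda b]$, $[a_\lambda b]=-[b_{-\lambda-\partial}a]$, $[a_\lambda[b_\mu c]]=[[a_\lambda b]_{\lambda+\mu}c]+[b_\mu[a_\lambda c]]$. The Lie conformal algebra corresponding to a GD algebra $(A,\circ,[\cdot,\cdot])$ is $\mathbf{k}[\partial]A$ with $[a_\lambda b]=\partial(b\circ a)+\lambda(a\star b)+[a,b]$ for $a,b\in A$, extended by the first two identities. For a finitely generated $\mathbf{k}[\partial]$-module $M$, $\mathrm{gc}(M)$ is the space of $\mathbf{k}$-linear maps $f_\lambda:M\to M[\lambda]$ with $f_\lambda(\partial v)=(\partial+\lambda)f_\lambda(v)$, with $\mathbf{k}[\partial]$-action $(\partial f)_\lambda=-\lambda f_\lambda$ (it is a Lie conformal algebra under $[f_\lambda g]_\mu v=f_\lambda(g_{\mu-\lambda}v)-g_{\mu-\lambda}(f_\lambda v)$). For linear maps $l,r,\rho:A\to\mathrm{End}_{\mathbf{k}}(V)$,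 $\rho_{l,r,\rho}:\mathbf{k}[\partial]A\to\mathrm{gc}(\mathbf{k}[\partial]V)$ is the $\mathbf{k}[\partial]$-module homomorphism determined by $\rho_{l,r,\rho}(a)_\lambda v=\partial(r(a)v)+\lambda(l(a)v+r(a)v)+\rho(a)v$ for $a\in A$, $v\in V$. For Lie conformal algebras $R_1,R_2$ and $\mathbf{k}[\partial]$-module homomorphisms $\rho:R_1\to\mathrm{gc}(R_2)$, $\sigma:R_2\to\mathrm{gc}(R_1)$, $(R_1,R_2,\rho,\sigma)$ is a matched pair of Lie conformal algebras if $R_1\oplus R_2$ is a Lie conformal algebra under $[(a+x)_\lambda(b+y)]=([a_\lambda b]+\sigma(x)_\lambda b-\sigma(y)_{-\lambda-\partial}a)+([x_\lambda y]+\rho(a)_\lambda y-\rho(b)_{-\lambda-\partial}x)$, for $a,b\in R_1$, $x,y\in R_2$. *)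

theory Defs
  imports
    "HOL-Computational_Algebra.Polynomial"
    "HOL-Library.Function_Algebras"
    "HOL-Analysis.Product_Vector"
begin

section \<open>Novikov, Lie and Gel'fand-Dorfman algebras\<close>

definition bilinear_map ::
  "('k::field \<Rightarrow> 'u::ab_group_add \<Rightarrow> 'u) \<Rightarrow> ('k \<Rightarrow> 'v::ab_group_add \<Rightarrow> 'v) \<Rightarrow>
   ('k \<Rightarrow> 'w::ab_group_add \<Rightarrow> 'w) \<Rightarrow> ('u \<Rightarrow> 'v \<Rightarrow> 'w) \<Rightarrow> bool" where
  "bilinear_map sU sV sW f \<longleftrightarrow>
     (\<forall>u. Vector_Spaces.linear sV sW (f u)) \<and>
     (\<forall>v. Vector_Spaces.linear sU sW (\<lambda>u. f u v))"

locale novikov_algebra = vector_space sA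
  for sA :: "'k::field_char_0 \<Rightarrow> 'a::ab_group_add \<Rightarrow> 'a" +
  fixes circ :: "'a \<Rightarrow> 'a \<Rightarrow> 'a"
  assumes circ_bilinear: "bilinear_map sA sA sA circ"
    and left_symmetric:
      "circ (circ a b) c - circ a (circ b c) = circ (circ b a) c - circ b (circ a c)"
    and right_commutative: "circ (circ a b) c = circ (circ a c) b"

locale lie_algebra = vector_space sA
  for sA :: "'k::field_char_0 \<Rightarrow> 'a::ab_group_add \<Rightarrow> 'a" +
  fixes br :: "'a \<Rightarrow> 'a \<Rightarrow> 'a"
  assumes br_bilinear: "bilinear_map sA sA sA br"
    and br_alternating: "br a a = 0"
    and br_jacobi: "br a (br b c) + br b (br c a) + br c (br a b) = 0"

locale gd_algebra = novikov_algebra sA circ + lie_algebra sA br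
  for sA :: "'k::field_char_0 \<Rightarrow> 'a::ab_group_add \<Rightarrow> 'a"
    and circ :: "'a \<Rightarrow> 'a \<Rightarrow> 'a"
    and br :: "'a \<Rightarrow> 'a \<Rightarrow> 'a" +
  assumes gd_compatible:
    "br (circ a b) c - br (circ a c) b + circ (br a b) c - circ (br a c) b - circ a (br b c) = 0"

text \<open>Linear maps from \<open>A\<close> to the space of \<open>k\<close>-linear endomorphisms of \<open>V\<close>, the latter with its
  pointwise operations.\<close>

definition linear_into_End ::
  "('k::field \<Rightarrow> 'a::ab_group_add \<Rightarrow> 'a) \<Rightarrow> ('k \<Rightarrow> 'v::ab_group_add \<Rightarrow> 'v) \<Rightarrow>
   ('a \<Rightarrow> 'v \<Rightarrow> 'v) \<Rightarrow> bool" where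
  "linear_into_End sA sV l \<longleftrightarrow>
     (\<forall>a. Vector_Spaces.linear sV sV (l a)) \<and>
     Vector_Spaces.linear sA (\<lambda>c f v. sV c (f v)) l"

fun gd_sum_circ ::
  "('a::ab_group_add \<Rightarrow> 'a \<Rightarrow> 'a) \<Rightarrow> ('b::ab_group_add \<Rightarrow> 'b \<Rightarrow> 'b) \<Rightarrow>
   ('a \<Rightarrow> 'b \<Rightarrow> 'b) \<Rightarrow> ('a \<Rightarrow> 'b \<Rightarrow> 'b) \<Rightarrow> ('b \<Rightarrow> 'a \<Rightarrow> 'a) \<Rightarrow> ('b \<Rightarrow> 'a \<Rightarrow> 'a) \<Rightarrow>
   'a \<times> 'b \<Rightarrow> 'a \<times> 'b \<Rightarrow> 'a \<times> 'b" where
  "gd_sum_circ circA circB lA rA lB rB (a, x) (b, y) =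
     (circA a b + lB x b + rB y a, circB x y + lA a y + rA b x)"

fun gd_sum_br ::
  "('a::ab_group_add \<Rightarrow> 'a \<Rightarrow> 'a) \<Rightarrow> ('b::ab_group_add \<Rightarrow> 'b \<Rightarrow> 'b) \<Rightarrow>
   ('a \<Rightarrow> 'b \<Rightarrow> 'b) \<Rightarrow> ('b \<Rightarrow> 'a \<Rightarrow> 'a) \<Rightarrow>
   'a \<times> 'b \<Rightarrow> 'a \<times> 'b \<Rightarrow> 'a \<times> 'b" where
  "gd_sum_br brA brB rhoA rhoB (a, x) (b, y) =
     (brA a b + rhoB x b - rhoB y a, brB x y + rhoA a y - rhoA b x)"

definition matched_pair_gd ::
  "('k::field_char_0 \<Rightarrow> 'a::ab_group_add \<Rightarrow> 'a) \<Rightarrow> ('a \<Rightarrow> 'a \<Rightarrow> 'a) \<Rightarrow> ('a \<Rightarrow> 'a \<Rightarrow> 'a) \<Rightarrow>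
   ('k \<Rightarrow> 'b::ab_group_add \<Rightarrow> 'b) \<Rightarrow> ('b \<Rightarrow> 'b \<Rightarrow> 'b) \<Rightarrow> ('b \<Rightarrow> 'b \<Rightarrow> 'b) \<Rightarrow>
   ('a \<Rightarrow> 'b \<Rightarrow> 'b) \<Rightarrow> ('a \<Rightarrow> 'b \<Rightarrow> 'b) \<Rightarrow> ('a \<Rightarrow> 'b \<Rightarrow> 'b) \<Rightarrow>
   ('b \<Rightarrow> 'a \<Rightarrow> 'a) \<Rightarrow> ('b \<Rightarrow> 'a \<Rightarrow> 'a) \<Rightarrow> ('b \<Rightarrow> 'a \<Rightarrow> 'a) \<Rightarrow> bool" where
  "matched_pair_gd sA circA brA sB circB brB lA rA rhoA lB rB rhoB \<longleftrightarrow>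
     gd_algebra sA circA brA \<and> gd_algebra sB circB brB \<and>
     linear_into_End sA sB lA \<and> linear_into_End sA sB rA \<and> linear_into_End sA sB rhoA \<and>
     linear_into_End sB sA lB \<and> linear_into_End sB sA rB \<and> linear_into_End sB sA rhoB \<and>
     gd_algebra (module_prod.scale sA sB)
       (gd_sum_circ circA circB lA rA lB rB) (gd_sum_br brA brB rhoA rhoB)"


section \<open>Lie conformal algebras\<close>

text \<open>
  A \<open>k[\<partial>]\<close>-module on a type \<open>'r\<close> is a module with scalars \<open>'k poly\<close>. The space \<open>R[\<lambda>]\<close> is the
  type \<open>'r poly\<close>: the coefficient of \<open>\<lambda>^n\<close> lies in \<open>R\<close>, and multiplication by \<open>\<lambda>\<close> is \<open>pCons 0\<close>.
\<close>

definition dact :: "('k::field_char_0 poly \<Rightarrow> 'r::ab_group_add \<Rightarrow> 'r) \<Rightarrow> 'r \<Rightarrow> 'r" where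
  "dact smul = smul [:0, 1:]"

definition kscale :: "('k::field_char_0 poly \<Rightarrow> 'r::ab_group_add \<Rightarrow> 'r) \<Rightarrow> 'k \<Rightarrow> 'r \<Rightarrow> 'r" where
  "kscale smul c = smul [:c:]"

definition lam :: "'r::zero poly \<Rightarrow> 'r poly" where
  "lam = pCons 0"

definition dact_poly ::
  "('k::field_char_0 poly \<Rightarrow> 'r::ab_group_add \<Rightarrow> 'r) \<Rightarrow> 'r poly \<Rightarrow> 'r poly" where
  "dact_poly smul = map_poly (dact smul)"

definition kscale_poly ::
  "('k::field_char_0 poly \<Rightarrow> 'r::ab_group_add \<Rightarrow> 'r) \<Rightarrow> 'k \<Rightarrow> 'r poly \<Rightarrow> 'r poly" where
  "kscale_poly smul c = map_poly (kscale smul c)"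

text \<open>\<open>poly_subst T e p = (\<Sum>n. T^n (e p\<^sub>n))\<close> substitutes the operator \<open>T\<close> for the variable of \<open>p\<close>,
  where \<open>e\<close> embeds the coefficients of \<open>p\<close> into the module on which \<open>T\<close> acts.\<close>

definition poly_subst ::
  "('m::comm_monoid_add \<Rightarrow> 'm) \<Rightarrow> ('c::zero \<Rightarrow> 'm) \<Rightarrow> 'c poly \<Rightarrow> 'm" where
  "poly_subst T e p = (\<Sum>n\<le>degree p. (T ^^ n) (e (coeff p n)))"

text \<open>Replace \<open>\<lambda>\<close> by \<open>-\<lambda> - \<partial>\<close>; the operator \<open>\<partial>\<close> acts on the coefficients.\<close>

definition neg_lam_d ::
  "('k::field_char_0 poly \<Rightarrow> 'r::ab_group_add \<Rightarrow> 'r) \<Rightarrow> 'r poly \<Rightarrow> 'r poly" where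
  "neg_lam_d smul = poly_subst (\<lambda>q. - lam q - dact_poly smul q) (\<lambda>r. [:r:])"

text \<open>\<open>R[\<lambda>,\<mu>]\<close> is \<open>'r poly poly\<close>, with \<open>\<mu>\<close> the outer and \<open>\<lambda>\<close> the inner variable.\<close>

definition mul_lambda :: "'r::zero poly poly \<Rightarrow> 'r poly poly" where
  "mul_lambda = map_poly (pCons 0)"

definition mul_mu :: "'r::zero poly poly \<Rightarrow> 'r poly poly" where
  "mul_mu = pCons 0"

definition const2 :: "'r::zero \<Rightarrow> 'r poly poly" where
  "const2 r = [:[:r:]:]"

text \<open>The three terms of the Jacobi identity below are
  \<open>[a\<^sub>\<lambda> [b\<^sub>\<mu> c]]\<close>, \<open>[[a\<^sub>\<lambda> b]\<^sub>\<lambda>\<^sub>+\<^sub>\<mu> c]\<close> and \<open>[b\<^sub>\<mu> [a\<^sub>\<lambda> c]]\<close>.\<close>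

locale lie_conformal_algebra = module smul
  for smul :: "'k::field_char_0 poly \<Rightarrow> 'r::ab_group_add \<Rightarrow> 'r" +
  fixes cbr :: "'r \<Rightarrow> 'r \<Rightarrow> 'r poly"
  assumes cbr_bilinear: "bilinear_map (kscale smul) (kscale smul) (kscale_poly smul) cbr"
    and sesquilinear_left: "cbr (dact smul a) b = - lam (cbr a b)"
    and sesquilinear_right: "cbr a (dact smul b) = lam (cbr a b) + dact_poly smul (cbr a b)"
    and skew_symmetric: "cbr a b = - neg_lam_d smul (cbr b a)"
    and jacobi:
      "poly_subst mul_mu (\<lambda>r. poly_subst mul_lambda const2 (cbr a r)) (cbr b c) =
       poly_subst mul_lambda
         (\<lambda>r. poly_subst (\<lambda>q. mul_lambda q + mul_mu q) const2 (cbr r c)) (cbr a b) +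
       poly_subst mul_lambda (\<lambda>r. poly_subst mul_mu const2 (cbr b r)) (cbr a c)"

text \<open>The space \<open>gc(M)\<close> as a subset of all maps \<open>M \<Rightarrow> M[\<lambda>]\<close>, and the action of \<open>k[\<partial>]\<close> on such maps
  given by \<open>(\<partial> f)\<^sub>\<lambda> = -\<lambda> f\<^sub>\<lambda>\<close>. Both make sense for every \<open>k[\<partial>]\<close>-module \<open>M\<close>.\<close>

definition gc ::
  "('k::field_char_0 poly \<Rightarrow> 'm::ab_group_add \<Rightarrow> 'm) \<Rightarrow> ('m \<Rightarrow> 'm poly) set" where
  "gc smul = {f. Vector_Spaces.linear (kscale smul) (kscale_poly smul) f \<and>
     (\<forall>v. f (dact smul v) = dact_poly smul (f v) + lam (f v))}"

definition gc_scale ::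
  "('k::field_char_0 poly \<Rightarrow> 'm::ab_group_add \<Rightarrow> 'm) \<Rightarrow>
   'k poly \<Rightarrow> ('m \<Rightarrow> 'm poly) \<Rightarrow> 'm \<Rightarrow> 'm poly" where
  "gc_scale smul p f = (\<lambda>v. poly_subst (\<lambda>q. - lam q) (\<lambda>c. kscale_poly smul c (f v)) p)"

definition gc_module_hom ::
  "('k::field_char_0 poly \<Rightarrow> 'r::ab_group_add \<Rightarrow> 'r) \<Rightarrow>
   ('k poly \<Rightarrow> 'm::ab_group_add \<Rightarrow> 'm) \<Rightarrow> ('r \<Rightarrow> 'm \<Rightarrow> 'm poly) \<Rightarrow> bool" where
  "gc_module_hom smulR smulM \<rho> \<longleftrightarrow>
     module_hom smulR (gc_scale smulM) \<rho> \<and> range \<rho> \<subseteq> gc smulM"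

text \<open>The identification of \<open>R1[\<lambda>] \<oplus> R2[\<lambda>]\<close> with \<open>(R1 \<oplus> R2)[\<lambda>]\<close>.\<close>

definition pair_poly ::
  "'r::ab_group_add poly \<Rightarrow> 's::ab_group_add poly \<Rightarrow> ('r \<times> 's) poly" where
  "pair_poly p q = map_poly (\<lambda>r. (r, 0)) p + map_poly (\<lambda>s. (0, s)) q"

fun lc_sum_br ::
  "('k::field_char_0 poly \<Rightarrow> 'r::ab_group_add \<Rightarrow> 'r) \<Rightarrow> ('r \<Rightarrow> 'r \<Rightarrow> 'r poly) \<Rightarrow>
   ('k poly \<Rightarrow> 's::ab_group_add \<Rightarrow> 's) \<Rightarrow> ('s \<Rightarrow> 's \<Rightarrow> 's poly) \<Rightarrow>
   ('r \<Rightarrow> 's \<Rightarrow> 's poly) \<Rightarrow> ('s \<Rightarrow> 'r \<Rightarrow> 'r poly) \<Rightarrow>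
   'r \<times> 's \<Rightarrow> 'r \<times> 's \<Rightarrow> ('r \<times> 's) poly" where
  "lc_sum_br smul1 cbr1 smul2 cbr2 \<rho> \<sigma> (a, x) (b, y) =
     pair_poly (cbr1 a b + \<sigma> x b - neg_lam_d smul1 (\<sigma> y a))
               (cbr2 x y + \<rho> a y - neg_lam_d smul2 (\<rho> b x))"

definition matched_pair_lc ::
  "('k::field_char_0 poly \<Rightarrow> 'r::ab_group_add \<Rightarrow> 'r) \<Rightarrow> ('r \<Rightarrow> 'r \<Rightarrow> 'r poly) \<Rightarrow>
   ('k poly \<Rightarrow> 's::ab_group_add \<Rightarrow> 's) \<Rightarrow> ('s \<Rightarrow> 's \<Rightarrow> 's poly) \<Rightarrow>
   ('r \<Rightarrow> 's \<Rightarrow> 's poly) \<Rightarrow> ('s \<Rightarrow> 'r \<Rightarrow> 'r poly) \<Rightarrow> bool" where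
  "matched_pair_lc smul1 cbr1 smul2 cbr2 \<rho> \<sigma> \<longleftrightarrow>
     lie_conformal_algebra smul1 cbr1 \<and> lie_conformal_algebra smul2 cbr2 \<and>
     gc_module_hom smul1 smul2 \<rho> \<and> gc_module_hom smul2 smul1 \<sigma> \<and>
     lie_conformal_algebra (module_prod.scale smul1 smul2)
       (lc_sum_br smul1 cbr1 smul2 cbr2 \<rho> \<sigma>)"


section \<open>The passage from Gel'fand-Dorfman algebras to Lie conformal algebras\<close>

text \<open>
  The free module \<open>k[\<partial>] \<otimes> A\<close> is the type \<open>'a poly\<close>: the coefficient of \<open>\<partial>^n\<close> lies in \<open>A\<close>.
  Hence \<open>(k[\<partial>] \<otimes> A)[\<lambda>]\<close> is \<open>'a poly poly\<close>, where \<open>\<lambda>\<close> is the outer and \<open>\<partial>\<close> the inner variable.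
\<close>

definition free_smul ::
  "('k::field_char_0 \<Rightarrow> 'a::ab_group_add \<Rightarrow> 'a) \<Rightarrow> 'k poly \<Rightarrow> 'a poly \<Rightarrow> 'a poly" where
  "free_smul sA p f = poly_subst (pCons 0) (\<lambda>c. map_poly (sA c) f) p"

text \<open>Extension of \<open>g : A \<times> V \<Rightarrow> (k[\<partial>]V)[\<lambda>]\<close> to \<open>k[\<partial>]A \<times> k[\<partial>]V\<close>, where \<open>\<partial>\<close> acts as \<open>-\<lambda>\<close> in the
  first argument and as \<open>\<lambda> + \<partial>\<close> in the second:
  \<open>(\<partial>^i a, \<partial>^j v)\<close> is sent to \<open>(-\<lambda>)^i (\<lambda> + \<partial>)^j g(a, v)\<close>.\<close>

definition sesqui_extend ::
  "('a::ab_group_add \<Rightarrow> 'v::ab_group_add \<Rightarrow> 'v poly poly) \<Rightarrow>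
   'a poly \<Rightarrow> 'v poly \<Rightarrow> 'v poly poly" where
  "sesqui_extend g p q =
     poly_subst (\<lambda>f. - lam f)
       (\<lambda>a. poly_subst (\<lambda>f. lam f + map_poly (pCons 0) f) (g a) q) p"

text \<open>On generators, \<open>[a\<^sub>\<lambda> b] = ([a, b] + \<partial>(b \<circ> a)) + \<lambda>(a \<circ> b + b \<circ> a)\<close>.\<close>

definition gd_cbr ::
  "('a::ab_group_add \<Rightarrow> 'a \<Rightarrow> 'a) \<Rightarrow> ('a \<Rightarrow> 'a \<Rightarrow> 'a) \<Rightarrow> 'a poly \<Rightarrow> 'a poly \<Rightarrow> 'a poly poly" where
  "gd_cbr circ br = sesqui_extend (\<lambda>a b. [:[:br a b, circ b a:], [:circ a b + circ b a:]:])"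

text \<open>On generators, \<open>\<rho>\<^sub>l\<^sub>,\<^sub>r\<^sub>,\<^sub>\<rho>(a)\<^sub>\<lambda> v = (\<rho>(a)v + \<partial>(r(a)v)) + \<lambda>(l(a)v + r(a)v)\<close>.\<close>

definition gd_rep ::
  "('a::ab_group_add \<Rightarrow> 'v::ab_group_add \<Rightarrow> 'v) \<Rightarrow> ('a \<Rightarrow> 'v \<Rightarrow> 'v) \<Rightarrow> ('a \<Rightarrow> 'v \<Rightarrow> 'v) \<Rightarrow>
   'a poly \<Rightarrow> 'v poly \<Rightarrow> 'v poly poly" where
  "gd_rep l r \<rho> = sesqui_extend (\<lambda>a v. [:[:\<rho> a v, r a v:], [:l a v + r a v:]:])"

end

theory Submission
  imports Defs
begin

text \<open>
  Write \<open>C = A \<oplus> B\<close> with the two products of the matched pair data. Both sides of the equivalence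
  are statements about \<open>C\<close>, and they are connected by two facts.

  First, for arbitrary bilinear products \<open>\<circ>\<close> and \<open>[\<cdot>,\<cdot>]\<close> on a vector space \<open>V\<close>, the bracket
  \<open>[a\<^sub>\<lambda> b] = \<partial>(b \<circ> a) + \<lambda>(a \<circ> b + b \<circ> a) + [a, b]\<close> makes \<open>k[\<partial>]V\<close> a Lie conformal algebra exactly
  when \<open>V\<close> is a Gel'fand-Dorfman algebra (\<open>lie_conformal_gd_iff\<close>). The point is that skew-symmetry
  and the Jacobi identity need only be tested on \<open>V\<close>: the defect of skew-symmetry is a sesquilinear
  map, and the Jacobiator is sesquilinear in each of its three arguments, in the sense that \<open>\<partial>\<close> acts
  through it by \<open>-\<lambda>\<close>, \<open>-\<mu>\<close> and \<open>\<lambda> + \<mu> + \<partial>\<close> respectively; such maps vanish as soon as they vanish on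
  generators (\<open>sesquilinear_unique\<close>, \<open>jacobiator_zero\<close>). On generators the Jacobiator is a polynomial
  in \<open>\<lambda>\<close>, \<open>\<mu>\<close>, \<open>\<partial>\<close> whose coefficients vanish by the Gel'fand-Dorfman axioms. Conversely, its
  coefficients at \<open>1\<close>, \<open>\<partial>\<close>, \<open>\<partial>\<^sup>2\<close> and \<open>\<lambda>\<partial>\<close>, together with skew-symmetry, give those axioms back.

  Second, \<open>k[\<partial>]C\<close> with this bracket is \<open>k[\<partial>]A \<oplus> k[\<partial>]B\<close> with the bracket of the matched pair of Lie
  conformal algebras (\<open>lc_sum_br_split_poly\<close>). Both brackets are sesquilinear, so this too is an
  identity between generators. The substitution \<open>\<lambda> \<mapsto> -\<lambda> - \<partial>\<close> in the mixed terms is what matches: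
  it turns \<open>-(\<partial> r(y)a + \<lambda>(l(y)a + r(y)a) + \<rho>(y)a)\<close> into \<open>\<partial> l(y)a + \<lambda>(l(y)a + r(y)a) - \<rho>(y)a\<close>, in
  which the roles of \<open>l\<close> and \<open>r\<close> are exchanged, as they are when \<open>y\<close> moves to the right of \<open>a\<close> in the
  product of \<open>C\<close>.

  The remaining clauses in the definition of a matched pair of Lie conformal algebras always hold:
  \<open>k[\<partial>]A\<close> and \<open>k[\<partial>]B\<close> are Lie conformal algebras by the first fact, and the maps into \<open>gc\<close> are
  homomorphisms because sesquilinear extensions of bilinear maps are
  (\<open>gc_module_hom_sesquilinear\<close>).
\<close>

section \<open>Additive maps and polynomial substitution\<close>

lemma additive_comp: "additive f \<Longrightarrow> additive g \<Longrightarrow> additive (\<lambda>x. f (g x))"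
  by (simp add: additive_def)

lemma additive_plus: "additive f \<Longrightarrow> additive g \<Longrightarrow> additive (\<lambda>x. f x + g x)"
  by (simp add: additive_def algebra_simps)

lemma additive_uminus: "additive f \<Longrightarrow> additive (\<lambda>x. - f x)"
  by (simp add: additive_def)

lemma additive_pCons: "additive (pCons 0 :: 'a::ab_group_add poly \<Rightarrow> _)"
  by (simp add: additive_def)

lemma additive_const_poly: "additive (\<lambda>x. [:x:])"
  by (simp add: additive_def)

lemma map_poly_add:
  assumes "additive h"
  shows "map_poly h (p + q) = map_poly h p + map_poly h q"
  using assms by (intro poly_eqI) (simp add: coeff_map_poly additive.zero additive.add)

lemma additive_map_poly: "additive h \<Longrightarrow> additive (map_poly h)"
  by (simp add: additive_def map_poly_add)

lemma map_poly_pCons_0: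
  "additive h \<Longrightarrow> map_poly h (pCons 0 p) = pCons 0 (map_poly h p)"
  by (simp add: map_poly_pCons additive.zero)

lemma additive_funpow:
  fixes T :: "'m::ab_group_add \<Rightarrow> 'm"
  shows "additive T \<Longrightarrow> additive (T ^^ n)"
  by (induction n) (simp_all add: additive_def)

text \<open>Summing beyond the degree is harmless, which allows two polynomials of different degrees to be
  substituted over a common range.\<close>

lemma poly_subst_bound:
  fixes T :: "'m::ab_group_add \<Rightarrow> 'm"
  assumes "additive T" "e 0 = 0" "degree p \<le> n"
  shows "poly_subst T e p = (\<Sum>i\<le>n. (T ^^ i) (e (coeff p i)))"
  unfolding poly_subst_def
  by (rule sum.mono_neutral_left)
    (use assms in \<open>auto simp: coeff_eq_0 additive.zero[OF additive_funpow]\<close>)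

lemma poly_subst_0 [simp]: "e 0 = 0 \<Longrightarrow> poly_subst T e 0 = e 0"
  by (simp add: poly_subst_def)

text \<open>The Horner scheme. It reduces every later statement about substitution to an induction on the
  polynomial in which degrees no longer appear.\<close>

lemma poly_subst_pCons:
  fixes T :: "'m::ab_group_add \<Rightarrow> 'm"
  assumes T: "additive T" and e: "e 0 = 0"
  shows "poly_subst T e (pCons a p) = e a + T (poly_subst T e p)"
proof -
  have "poly_subst T e (pCons a p) = (\<Sum>i\<le>Suc (degree p). (T ^^ i) (e (coeff (pCons a p) i)))"
    using assms by (intro poly_subst_bound) (auto simp: degree_pCons_le)
  also have "\<dots> = e a + (\<Sum>i\<le>degree p. (T ^^ Suc i) (e (coeff p i)))"
    by (subst sum.atMost_Suc_shift) simp
  also have "\<dots> = e a + T (poly_subst T e p)"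
    by (simp add: poly_subst_def additive.sum[OF T])
  finally show ?thesis .
qed

lemma poly_subst_add:
  fixes T :: "'m::ab_group_add \<Rightarrow> 'm"
  assumes T: "additive T" and e: "additive e"
  shows "poly_subst T e (p + q) = poly_subst T e p + poly_subst T e q"
proof -
  let ?n = "max (degree p) (degree q)"
  have "poly_subst T e r = (\<Sum>i\<le>?n. (T ^^ i) (e (coeff r i)))" if "degree r \<le> ?n" for r
    using that T e by (intro poly_subst_bound) (auto simp: additive.zero)
  then show ?thesis
    by (simp add: degree_add_le_max additive.add[OF e] additive.add[OF additive_funpow[OF T]]
        sum.distrib)
qed

lemma additive_poly_subst: "additive T \<Longrightarrow> additive e \<Longrightarrow> additive (poly_subst T e)"
  by (simp add: additive_def poly_subst_add)

lemma poly_subst_lam: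
  fixes T :: "'m::ab_group_add \<Rightarrow> 'm"
  shows "additive T \<Longrightarrow> e 0 = 0 \<Longrightarrow> poly_subst T e (lam p) = T (poly_subst T e p)"
  by (simp add: lam_def poly_subst_pCons)

text \<open>A map that carries the operator \<open>T\<close> to \<open>T'\<close> can be moved inside the substitution. This
  serves both for endomorphisms that commute with \<open>T\<close> and for changes of the module.\<close>

lemma poly_subst_intertwine:
  fixes T :: "'m::ab_group_add \<Rightarrow> 'm" and T' :: "'n::ab_group_add \<Rightarrow> 'n"
  assumes T: "additive T" "additive T'" and U: "additive U"
    and UT: "\<And>x. U (T x) = T' (U x)" and e: "e 0 = 0"
  shows "U (poly_subst T e p) = poly_subst T' (\<lambda>r. U (e r)) p"
  by (induction p) (simp_all add: poly_subst_pCons T e additive.zero[OF U] additive.add[OF U] UT)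

lemma poly_subst_map_poly:
  fixes T :: "'m::ab_group_add \<Rightarrow> 'm"
  assumes T: "additive T" and h: "h 0 = 0" and e: "e 0 = 0"
  shows "poly_subst T e (map_poly h p) = poly_subst T (\<lambda>r. e (h r)) p"
  by (induction p) (simp_all add: poly_subst_pCons T e h map_poly_pCons)

lemma poly_subst_add_embed:
  fixes T :: "'m::ab_group_add \<Rightarrow> 'm"
  assumes T: "additive T" and e: "e 0 = 0" "e' 0 = 0"
  shows "poly_subst T (\<lambda>r. e r + e' r) p = poly_subst T e p + poly_subst T e' p"
  by (induction p) (simp_all add: poly_subst_pCons T e additive.add[OF T])

section \<open>Sesquilinear maps\<close>

text \<open>The operators on the two arguments and on the coefficients of the values are kept apart, so that
  brackets, actions \<open>R \<times> M \<Rightarrow> M[\<lambda>]\<close>, and actions with their arguments exchanged are all instances.\<close>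

definition sesquilinear ::
  "('r::ab_group_add \<Rightarrow> 'r) \<Rightarrow> ('s::ab_group_add \<Rightarrow> 's) \<Rightarrow> ('m::ab_group_add \<Rightarrow> 'm) \<Rightarrow>
   ('r \<Rightarrow> 's \<Rightarrow> 'm poly) \<Rightarrow> bool" where
  "sesquilinear dR dS dM f \<longleftrightarrow>
     (\<forall>a. additive (f a)) \<and> (\<forall>b. additive (\<lambda>a. f a b)) \<and>
     (\<forall>a b. f (dR a) b = - lam (f a b)) \<and>
     (\<forall>a b. f a (dS b) = lam (f a b) + map_poly dM (f a b))"

lemma sesquilinearD:
  assumes "sesquilinear dR dS dM f"
  shows "additive (f a)" "additive (\<lambda>a. f a b)"
    "f (dR a) b = - lam (f a b)" "f a (dS b) = lam (f a b) + map_poly dM (f a b)"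
  using assms by (simp_all add: sesquilinear_def)

lemma sesquilinear_0:
  assumes "sesquilinear dR dS dM f"
  shows "f 0 b = 0" "f a 0 = 0"
  using additive.zero[OF sesquilinearD(1)[OF assms]] additive.zero[OF sesquilinearD(2)[OF assms]]
  by simp_all

lemma additive_lam: "additive (lam :: 'm::ab_group_add poly \<Rightarrow> _)"
  by (simp add: lam_def additive_pCons)

lemma map_poly_lam: "additive h \<Longrightarrow> map_poly h (lam p) = lam (map_poly h p)"
  by (simp add: lam_def map_poly_pCons_0)

lemma sesquilinear_add:
  assumes "sesquilinear dR dS dM f" "sesquilinear dR dS dM g" "additive dM"
  shows "sesquilinear dR dS dM (\<lambda>a b. f a b + g a b)"
  using assms unfolding sesquilinear_def
  by (auto intro: additive_plus simp: additive.add[OF additive_lam] map_poly_add)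

text \<open>Sesquilinearity survives any change of modules along maps that commute with the operators.\<close>

lemma sesquilinear_comp:
  assumes f: "sesquilinear dR dS dM f"
    and g: "additive g" "\<And>x. g (dR' x) = dR (g x)"
    and h: "additive h" "\<And>x. h (dS' x) = dS (h x)"
    and k: "additive k" "\<And>x. k (dM x) = dM' (k x)" "additive dM" "additive dM'"
  shows "sesquilinear dR' dS' dM' (\<lambda>a b. map_poly k (f (g a) (h b)))"
  unfolding sesquilinear_def
proof (intro conjI allI)
  fix a b
  show "additive (\<lambda>b. map_poly k (f (g a) (h b)))"
    by (intro additive_comp[OF additive_map_poly[OF k(1)]] additive_comp[OF sesquilinearD(1)[OF f] h(1)])
  show "additive (\<lambda>a. map_poly k (f (g a) (h b)))"
    by (intro additive_comp[OF additive_map_poly[OF k(1)]] additive_comp[OF sesquilinearD(2)[OF f] g(1)])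
  show "map_poly k (f (g (dR' a)) (h b)) = - lam (map_poly k (f (g a) (h b)))"
    by (simp add: g sesquilinearD(3)[OF f] additive.minus[OF additive_map_poly[OF k(1)]]
        map_poly_lam k)
  have "map_poly k (map_poly dM p) = map_poly dM' (map_poly k p)" for p
    using k by (simp add: map_poly_map_poly additive.zero o_def)
  then show "map_poly k (f (g a) (h (dS' b))) =
      lam (map_poly k (f (g a) (h b))) + map_poly dM' (map_poly k (f (g a) (h b)))"
    by (simp add: h sesquilinearD(4)[OF f] map_poly_add k map_poly_lam)
qed

text \<open>The substitution \<open>\<lambda> \<mapsto> -\<lambda> - \<partial>\<close> with an arbitrary endomorphism in the role of \<open>\<partial>\<close>.\<close>

definition reflect :: "('m::ab_group_add \<Rightarrow> 'm) \<Rightarrow> 'm poly \<Rightarrow> 'm poly" where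
  "reflect d = poly_subst (\<lambda>q. - lam q - map_poly d q) (\<lambda>r. [:r:])"

lemma additive_reflect_operator:
  "additive d \<Longrightarrow> additive (\<lambda>q. - lam q - map_poly d q)"
  using additive_plus[OF additive_uminus[OF additive_lam] additive_uminus[OF additive_map_poly]]
  by fastforce

lemma additive_reflect: "additive d \<Longrightarrow> additive (reflect d)"
  unfolding reflect_def
  by (intro additive_poly_subst additive_reflect_operator additive_const_poly)

lemma reflect_lam:
  "additive d \<Longrightarrow> reflect d (lam p) = - lam (reflect d p) - map_poly d (reflect d p)"
  unfolding reflect_def by (subst poly_subst_lam) (auto intro: additive_reflect_operator)

lemma reflect_map_poly:
  assumes k: "additive k" and d: "additive d" "additive d'" and kd: "\<And>x. k (d x) = d' (k x)"
  shows "map_poly k (reflect d p) = reflect d' (map_poly k p)"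
proof -
  have k0: "k 0 = 0" by (rule additive.zero[OF k])
  have comm: "map_poly k (map_poly d q) = map_poly d' (map_poly k q)" for q
    using k d kd by (simp add: map_poly_map_poly additive.zero o_def)
  have "map_poly k (reflect d p) =
      poly_subst (\<lambda>q. - lam q - map_poly d' q) (\<lambda>r. map_poly k [:r:]) p"
    unfolding reflect_def
    by (rule poly_subst_intertwine)
      (simp_all add: additive_reflect_operator d additive_map_poly k comm map_poly_lam
        additive.diff[OF additive_map_poly[OF k]] additive.minus[OF additive_map_poly[OF k]])
  also have "\<dots> = reflect d' (map_poly k p)"
    unfolding reflect_def
    by (subst poly_subst_map_poly) (simp_all add: additive_reflect_operator d k0 map_poly_pCons)
  finally show ?thesis .
qed

text \<open>The substitution exchanges the two laws: under \<open>\<lambda> \<mapsto> -\<lambda> - \<partial>\<close> the factor \<open>\<lambda> + \<partial>\<close> by which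
  the second argument acts becomes \<open>-\<lambda>\<close>, and the factor \<open>-\<lambda>\<close> of the first becomes \<open>\<lambda> + \<partial>\<close>. Hence
  skew-symmetry compares two sesquilinear maps.\<close>

lemma sesquilinear_swap:
  assumes f: "sesquilinear dR dS dM f" and d: "additive dM"
  shows "sesquilinear dS dR dM (\<lambda>b a. - reflect dM (f a b))"
  unfolding sesquilinear_def
proof (intro conjI allI)
  fix a b
  note N = additive_reflect[OF d]
  show "additive (\<lambda>a. - reflect dM (f a b))" for b
    by (intro additive_uminus additive_comp[OF N] sesquilinearD(2)[OF f])
  show "additive (\<lambda>b. - reflect dM (f a b))" for a
    by (intro additive_uminus additive_comp[OF N] sesquilinearD(1)[OF f])
  have "reflect dM (map_poly dM p) = map_poly dM (reflect dM p)" for p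
    using reflect_map_poly[OF d d d] by simp
  then show "- reflect dM (f b (dS a)) = - lam (- reflect dM (f b a))"
    by (simp add: sesquilinearD(4)[OF f] additive.add[OF N] reflect_lam d
        additive.minus[OF additive_lam])
  show "- reflect dM (f (dR b) a) =
      lam (- reflect dM (f b a)) + map_poly dM (- reflect dM (f b a))"
    by (simp add: sesquilinearD(3)[OF f] additive.minus[OF N] reflect_lam d
        additive.minus[OF additive_lam] additive.minus[OF additive_map_poly[OF d]])
qed

lemma pCons_split: "pCons a p = [:a:] + pCons 0 p" for a :: "'a::ab_group_add"
  by simp

text \<open>A polynomial is built from constants by addition and \<open>\<partial> = pCons 0\<close>, and sesquilinearity
  prescribes the effect of both on either argument.\<close>

lemma sesquilinear_unique:
  assumes f: "sesquilinear (pCons 0) (pCons 0) dM f"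
    and g: "sesquilinear (pCons 0) (pCons 0) dM g"
    and eq: "\<And>a b. f [:a:] [:b:] = g [:a:] [:b:]"
  shows "f p q = g p q"
proof -
  have *: "f [:a:] q = g [:a:] q" for a
  proof (induction q)
    case 0
    show ?case using sesquilinear_0[OF f] sesquilinear_0[OF g] by simp
  next
    case (pCons b q)
    then show ?case
      by (subst (1 2) pCons_split)
        (simp only: additive.add[OF sesquilinearD(1)[OF f]] additive.add[OF sesquilinearD(1)[OF g]]
          sesquilinearD(4)[OF f] sesquilinearD(4)[OF g] eq)
  qed
  show ?thesis
  proof (induction p)
    case 0
    show ?case using sesquilinear_0[OF f] sesquilinear_0[OF g] by simp
  next
    case (pCons a p)
    then show ?case
      by (subst (1 2) pCons_split)
        (simp only: additive.add[OF sesquilinearD(2)[OF f]] additive.add[OF sesquilinearD(2)[OF g]]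
          sesquilinearD(3)[OF f] sesquilinearD(3)[OF g] *)
  qed
qed

lemma additive_lam_plus: "additive d \<Longrightarrow> additive (\<lambda>q. lam q + map_poly d q)"
  by (intro additive_plus additive_lam additive_map_poly)

text \<open>The operators \<open>-\<lambda>\<close> and \<open>\<lambda> + \<partial>\<close> commute, so it does not matter that the definition
  substitutes in the second argument first.\<close>

lemma
  fixes g :: "'a::ab_group_add \<Rightarrow> 'v::ab_group_add \<Rightarrow> 'v poly poly"
  assumes g: "\<And>a. additive (g a)" "\<And>b. additive (\<lambda>a. g a b)"
  shows sesquilinear_sesqui_extend: "sesquilinear (pCons 0) (pCons 0) (pCons 0) (sesqui_extend g)"
    and sesqui_extend_const: "sesqui_extend g [:a:] [:b:] = g a b"
proof -
  define L where "L f = - lam f" for f :: "'v poly poly"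
  define M where "M f = lam f + map_poly (pCons 0) f" for f :: "'v poly poly"
  have L: "additive L" and M: "additive M"
    unfolding L_def M_def
    by (intro additive_uminus additive_lam additive_lam_plus additive_pCons)+
  note lam_add = additive.add[OF additive_lam] additive.minus[OF additive_lam]
  have LM: "M (L q) = L (M q)" for q
    by (simp add: L_def M_def lam_add additive.minus[OF additive_map_poly[OF additive_pCons]]
        map_poly_lam additive_pCons)
  have ext: "sesqui_extend g p q = poly_subst L (\<lambda>a. poly_subst M (g a) q) p" for p q
    by (simp add: sesqui_extend_def L_def[abs_def] M_def[abs_def])
  have inner: "additive (\<lambda>a. poly_subst M (g a) q)" for q
  proof -
    have "g (x + y) = (\<lambda>b. g x b + g y b)" for x y
      by (simp add: fun_eq_iff additive.add[OF g(2)])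
    then show ?thesis
      unfolding additive_def by (simp add: poly_subst_add_embed M additive.zero[OF g(1)])
  qed
  have inner_q: "additive (poly_subst M (g a))" for a
    by (intro additive_poly_subst M g)
  have zero: "g a 0 = 0" "g 0 b = 0" for a b
    using additive.zero[OF g(1)] additive.zero[OF g(2)] by auto
  show "sesqui_extend g [:a:] [:b:] = g a b"
    by (simp add: ext poly_subst_pCons L M zero additive.zero[OF inner] additive.zero[OF L] additive.zero[OF M])
  show "sesquilinear (pCons 0) (pCons 0) (pCons 0) (sesqui_extend g)"
    unfolding sesquilinear_def
  proof (intro conjI allI)
    fix p q
    show "additive (sesqui_extend g p)"
      unfolding additive_def ext
      by (simp add: additive.add[OF inner_q] poly_subst_add_embed L additive.zero[OF inner])
    show "additive (\<lambda>p. sesqui_extend g p q)"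
      unfolding ext by (intro additive_poly_subst L inner)
    show "sesqui_extend g (pCons 0 p) q = - lam (sesqui_extend g p q)"
      by (simp add: ext poly_subst_pCons L additive.zero[OF inner]) (simp add: L_def)
    have "sesqui_extend g p (pCons 0 q) = M (sesqui_extend g p q)"
      unfolding ext
      by (simp add: poly_subst_pCons M zero
          poly_subst_intertwine[of L L M "\<lambda>a. poly_subst M (g a) q", OF L L M LM additive.zero[OF inner]])
    then show "sesqui_extend g p (pCons 0 q) =
        lam (sesqui_extend g p q) + map_poly (pCons 0) (sesqui_extend g p q)"
      by (simp add: M_def)
  qed
qed

section \<open>The Jacobiator\<close>

text \<open>The terms \<open>[a\<^sub>\<lambda> [b\<^sub>\<mu> c]]\<close>, \<open>[[a\<^sub>\<lambda> b]\<^sub>\<lambda>\<^sub>+\<^sub>\<mu> c]\<close> and \<open>[b\<^sub>\<mu> [a\<^sub>\<lambda> c]]\<close> of the Jacobi identity.\<close>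

definition jac_outer :: "('r::ab_group_add \<Rightarrow> 'r \<Rightarrow> 'r poly) \<Rightarrow> 'r \<Rightarrow> 'r \<Rightarrow> 'r \<Rightarrow> 'r poly poly" where
  "jac_outer cbr a b c =
     poly_subst mul_mu (\<lambda>r. poly_subst mul_lambda const2 (cbr a r)) (cbr b c)"

definition jac_inner :: "('r::ab_group_add \<Rightarrow> 'r \<Rightarrow> 'r poly) \<Rightarrow> 'r \<Rightarrow> 'r \<Rightarrow> 'r \<Rightarrow> 'r poly poly" where
  "jac_inner cbr a b c =
     poly_subst mul_lambda
       (\<lambda>r. poly_subst (\<lambda>q. mul_lambda q + mul_mu q) const2 (cbr r c)) (cbr a b)"

definition jac_middle :: "('r::ab_group_add \<Rightarrow> 'r \<Rightarrow> 'r poly) \<Rightarrow> 'r \<Rightarrow> 'r \<Rightarrow> 'r \<Rightarrow> 'r poly poly" where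
  "jac_middle cbr a b c =
     poly_subst mul_lambda (\<lambda>r. poly_subst mul_mu const2 (cbr b r)) (cbr a c)"

definition jacobiator :: "('r::ab_group_add \<Rightarrow> 'r \<Rightarrow> 'r poly) \<Rightarrow> 'r \<Rightarrow> 'r \<Rightarrow> 'r \<Rightarrow> 'r poly poly" where
  "jacobiator cbr a b c = jac_outer cbr a b c - jac_inner cbr a b c - jac_middle cbr a b c"

lemma additive_mul_lambda: "additive (mul_lambda :: 'r::ab_group_add poly poly \<Rightarrow> _)"
  unfolding mul_lambda_def by (intro additive_map_poly additive_pCons)

lemma additive_mul_mu: "additive (mul_mu :: 'r::ab_group_add poly poly \<Rightarrow> _)"
  unfolding mul_mu_def by (rule additive_pCons)

lemma additive_const2: "additive (const2 :: 'r::ab_group_add \<Rightarrow> _)"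
  by (simp add: additive_def const2_def)

lemma additive_lambda_plus_mu:
  "additive (\<lambda>q :: 'r::ab_group_add poly poly. mul_lambda q + mul_mu q)"
  by (intro additive_plus additive_mul_lambda additive_mul_mu)

lemma mul_lambda_mu: "mul_lambda (mul_mu q) = mul_mu (mul_lambda q)"
  for q :: "'r::ab_group_add poly poly"
  by (simp add: mul_lambda_def mul_mu_def map_poly_pCons_0 additive_pCons)

lemma coefficientwise_mul:
  assumes h: "additive h"
  shows "map_poly (map_poly h) (mul_lambda q) = mul_lambda (map_poly (map_poly h) q)"
    and "map_poly (map_poly h) (mul_mu q) = mul_mu (map_poly (map_poly h) q)"
    and "map_poly (map_poly h) (const2 r) = const2 (h r)"
  using h by (auto simp: mul_lambda_def mul_mu_def const2_def map_poly_pCons_0 additive_map_poly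
      map_poly_map_poly o_def map_poly_pCons additive.zero)

lemmas additive_evaluation =
  additive_poly_subst[OF _ additive_const2]

lemma poly_subst_const2_map_poly:
  fixes T :: "'m::ab_group_add poly poly \<Rightarrow> 'm poly poly"
  assumes T: "additive T" and d: "additive d"
    and DT: "\<And>q. map_poly (map_poly d) (T q) = T (map_poly (map_poly d) q)"
  shows "poly_subst T const2 (map_poly d p) = map_poly (map_poly d) (poly_subst T const2 p)"
proof -
  have "map_poly (map_poly d) (poly_subst T const2 p)
      = poly_subst T (\<lambda>r. map_poly (map_poly d) (const2 r)) p"
    by (intro poly_subst_intertwine T additive_map_poly d DT additive.zero[OF additive_const2])
  also have "\<dots> = poly_subst T const2 (map_poly d p)"
    by (simp add: coefficientwise_mul d poly_subst_map_poly T additive.zero[OF d]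
        additive.zero[OF additive_const2])
  finally show ?thesis by simp
qed

text \<open>
  Each of the three terms has the sesquilinearity claimed here. In two places the factor arises only
  after a cancellation or an addition: in \<open>[[a\<^sub>\<lambda> \<partial>b]\<^sub>\<lambda>\<^sub>+\<^sub>\<mu> c]\<close> the factor is \<open>\<lambda> - (\<lambda> + \<mu>)\<close>, and an
  operator \<open>\<partial>\<close> on the last argument of a nested bracket collects one variable at each level.
\<close>

lemma
  assumes f: "sesquilinear d d d cbr" and d: "additive d"
  shows additive_jacobiator_1: "additive (\<lambda>a. jacobiator cbr a b c)"
    and additive_jacobiator_2: "additive (\<lambda>b. jacobiator cbr a b c)"
    and additive_jacobiator_3: "additive (\<lambda>c. jacobiator cbr a b c)"
    and jacobiator_d_1: "jacobiator cbr (d a) b c = - mul_lambda (jacobiator cbr a b c)"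
    and jacobiator_d_2: "jacobiator cbr a (d b) c = - mul_mu (jacobiator cbr a b c)"
    and jacobiator_d_3: "jacobiator cbr a b (d c) =
      mul_lambda (jacobiator cbr a b c) + mul_mu (jacobiator cbr a b c) +
      map_poly (map_poly d) (jacobiator cbr a b c)"
proof -
  let ?D = "map_poly (map_poly d)" and ?S = "\<lambda>q. mul_lambda q + mul_mu q"
  \<comment> \<open>The evaluations \<open>[a\<^sub>\<lambda> r]\<close>, \<open>[r\<^sub>\<lambda>\<^sub>+\<^sub>\<mu> c]\<close> and \<open>[b\<^sub>\<mu> r]\<close> in \<open>R[\<lambda>,\<mu>]\<close>, as biadditive maps.\<close>
  define X where "X a r = poly_subst mul_lambda const2 (cbr a r)" for a r
  define Y where "Y r c = poly_subst ?S const2 (cbr r c)" for r c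
  define Z where "Z b r = poly_subst mul_mu const2 (cbr b r)" for b r
  note ad = additive_mul_lambda additive_mul_mu additive_lambda_plus_mu
  note ad_rules = additive.add[OF additive_mul_lambda] additive.add[OF additive_mul_mu]
    additive.minus[OF additive_mul_lambda] additive.minus[OF additive_mul_mu]
    additive.diff[OF additive_mul_lambda] additive.diff[OF additive_mul_mu]
  have D: "additive ?D" by (intro additive_map_poly d)
  note D_rules = additive.add[OF D] additive.minus[OF D] additive.diff[OF D]
    coefficientwise_mul[OF d]
  have X_add: "additive (X a)" "additive (\<lambda>a. X a r)" for a r
    unfolding X_def
    by (intro additive_comp[OF additive_evaluation] ad sesquilinearD[OF f])+
  have Y_add: "additive (Y a)" "additive (\<lambda>a. Y a r)" for a r
    unfolding Y_def
    by (intro additive_comp[OF additive_evaluation] ad sesquilinearD[OF f])+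
  have Z_add: "additive (Z a)" "additive (\<lambda>a. Z a r)" for a r
    unfolding Z_def
    by (intro additive_comp[OF additive_evaluation] ad sesquilinearD[OF f])+
  have ev: "poly_subst T const2 (- lam p) = - T (poly_subst T const2 p)"
    "poly_subst T const2 (lam p + map_poly d p) =
       T (poly_subst T const2 p) + ?D (poly_subst T const2 p)"
    if "additive T" "\<And>q. ?D (T q) = T (?D q)" for p and T :: "'a poly poly \<Rightarrow> 'a poly poly"
    using that
    by (simp_all add: additive.minus[OF additive_evaluation] additive.add[OF additive_evaluation]
        poly_subst_lam additive.zero[OF additive_const2] poly_subst_const2_map_poly d)
  have Xd: "X (d a) r = - mul_lambda (X a r)" "X a (d r) = mul_lambda (X a r) + ?D (X a r)" for a r
    by (simp_all add: X_def sesquilinearD[OF f] ev ad D_rules)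
  have Yd: "Y (d a) r = - ?S (Y a r)" "Y a (d r) = ?S (Y a r) + ?D (Y a r)" for a r
    unfolding Y_def sesquilinearD(3,4)[OF f]
    by (intro ev ad; simp add: D_rules)+
  have Zd: "Z (d a) r = - mul_mu (Z a r)" "Z a (d r) = mul_mu (Z a r) + ?D (Z a r)" for a r
    by (simp_all add: Z_def sesquilinearD[OF f] ev ad D_rules)

  have jac: "jac_outer cbr a b c = poly_subst mul_mu (X a) (cbr b c)"
    "jac_inner cbr a b c = poly_subst mul_lambda (\<lambda>r. Y r c) (cbr a b)"
    "jac_middle cbr a b c = poly_subst mul_lambda (Z b) (cbr a c)" for a b c
    by (simp_all add: jac_outer_def jac_inner_def jac_middle_def X_def[abs_def] Y_def[abs_def]
        Z_def[abs_def])
  \<comment> \<open>How the outer substitution reacts to a change of the polynomial (\<open>out\<close>) and to a change of the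
      map on its coefficients (\<open>emb\<close>, \<open>emb2\<close>, \<open>embn\<close>).\<close>
  have out: "poly_subst T e (- lam p) = - T (poly_subst T e p)"
    "poly_subst T e (lam p + map_poly d p) = T (poly_subst T e p) + poly_subst T (\<lambda>r. e (d r)) p"
    "poly_subst T e (p + q) = poly_subst T e p + poly_subst T e q"
    if "additive T" "additive e" for T e p q
    using that
    by (simp_all add: additive.minus[OF additive_poly_subst] poly_subst_add poly_subst_lam
        additive.zero poly_subst_map_poly d)
  have emb: "poly_subst T (\<lambda>r. U (e r)) p = U (poly_subst T e p)"
    if "additive T" "additive e" "additive U" "\<And>x. U (T x) = T (U x)" for T e U p
    using that by (simp add: poly_subst_intertwine[of T T U] additive.zero)
  have emb2: "poly_subst T (\<lambda>r. e r + e' r) p = poly_subst T e p + poly_subst T e' p"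
    if "additive T" "additive e" "additive e'" for T e e' p
    using that by (simp add: poly_subst_add_embed additive.zero)

  have split: "X (a + a') = (\<lambda>r. X a r + X a' r)" "Z (a + a') = (\<lambda>r. Z a r + Z a' r)" for a a'
    by (simp_all add: fun_eq_iff additive.add[OF X_add(2)] additive.add[OF Z_add(2)])
  show "additive (\<lambda>a. jacobiator cbr a b c)"
    unfolding additive_def jacobiator_def jac
    by (simp add: split additive.add[OF sesquilinearD(2)[OF f]]
        emb2 ad X_add Y_add Z_add out)
  show "additive (\<lambda>b. jacobiator cbr a b c)"
    unfolding additive_def jacobiator_def jac
    by (simp add: split additive.add[OF sesquilinearD(2)[OF f]]
        additive.add[OF sesquilinearD(1)[OF f]] emb2 ad X_add Y_add Z_add out)
  show "additive (\<lambda>c. jacobiator cbr a b c)"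
    unfolding additive_def jacobiator_def jac
    by (simp add: additive.add[OF Y_add(1)]
        additive.add[OF sesquilinearD(1)[OF f]] emb2 ad X_add Y_add Z_add out)
  have embn: "poly_subst T (\<lambda>r. - U (e r)) p = - U (poly_subst T e p)"
    if "additive T" "additive e" "additive U" "\<And>x. U (T x) = T (U x)" for T e U p
    using that by (intro emb[of T e "\<lambda>x. - U x"]) (simp_all add: additive_uminus additive.minus)
  have outer_d: "jac_outer cbr (d a) b c = - mul_lambda (jac_outer cbr a b c)"
    "jac_outer cbr a (d b) c = - mul_mu (jac_outer cbr a b c)"
    "jac_outer cbr a b (d c) = ?S (jac_outer cbr a b c) + ?D (jac_outer cbr a b c)" for a b c
  proof -
    have X_d: "X (d a) = (\<lambda>r. - mul_lambda (X a r))"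
      by (rule ext) (rule Xd)
    show "jac_outer cbr (d a) b c = - mul_lambda (jac_outer cbr a b c)"
      unfolding jac X_d
      by (rule embn[of mul_mu _ mul_lambda, OF ad(2) X_add(1)[of a] ad(1) mul_lambda_mu])
    show "jac_outer cbr a (d b) c = - mul_mu (jac_outer cbr a b c)"
      unfolding jac sesquilinearD(3)[OF f] by (rule out(1)[OF ad(2) X_add(1)[of a]])
    show "jac_outer cbr a b (d c) = ?S (jac_outer cbr a b c) + ?D (jac_outer cbr a b c)"
      unfolding jac sesquilinearD(4)[OF f] out(2)[OF ad(2) X_add(1)[of a]] Xd
      by (subst emb2, (intro ad additive_comp[OF ad(1)] additive_comp[OF D] X_add)+)
        (simp only: emb[of mul_mu _ mul_lambda, OF ad(2) X_add(1)[of a] ad(1) mul_lambda_mu]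
          emb[of mul_mu _ "?D", OF ad(2) X_add(1)[of a] D D_rules(5)]
          ac_simps)
  qed
  have inner_d: "jac_inner cbr (d a) b c = - mul_lambda (jac_inner cbr a b c)"
    "jac_inner cbr a (d b) c = - mul_mu (jac_inner cbr a b c)"
    "jac_inner cbr a b (d c) = ?S (jac_inner cbr a b c) + ?D (jac_inner cbr a b c)" for a b c
  proof -
    have S: "?S (mul_lambda q) = mul_lambda (?S q)" for q :: "'a poly poly"
      by (simp add: mul_lambda_mu ad_rules)
    show "jac_inner cbr (d a) b c = - mul_lambda (jac_inner cbr a b c)"
      by (simp add: jac sesquilinearD(3,4)[OF f] out ad Y_add)
    show "jac_inner cbr a (d b) c = - mul_mu (jac_inner cbr a b c)"
      unfolding jac sesquilinearD(4)[OF f] out(2)[OF ad(1) Y_add(2)[of c]] Yd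
      by (subst embn[of mul_lambda _ "?S", OF ad(1) Y_add(2)[of c] ad(3) S]) simp
    show "jac_inner cbr a b (d c) = ?S (jac_inner cbr a b c) + ?D (jac_inner cbr a b c)"
      unfolding jac Yd
      by (subst emb2, (intro ad additive_comp[OF ad(3)] additive_comp[OF D] Y_add)+)
        (simp only: emb[of mul_lambda _ "?S", OF ad(1) Y_add(2)[of c] ad(3) S]
            emb[of mul_lambda _ "?D", OF ad(1) Y_add(2)[of c] D D_rules(4)])
  qed
  have middle_d: "jac_middle cbr (d a) b c = - mul_lambda (jac_middle cbr a b c)"
    "jac_middle cbr a (d b) c = - mul_mu (jac_middle cbr a b c)"
    "jac_middle cbr a b (d c) = ?S (jac_middle cbr a b c) + ?D (jac_middle cbr a b c)" for a b c
  proof -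
    have Z_d: "Z (d b) = (\<lambda>r. - mul_mu (Z b r))"
      by (rule ext) (rule Zd)
    show "jac_middle cbr (d a) b c = - mul_lambda (jac_middle cbr a b c)"
      unfolding jac sesquilinearD(3)[OF f] by (rule out(1)[OF ad(1) Z_add(1)[of b]])
    show "jac_middle cbr a (d b) c = - mul_mu (jac_middle cbr a b c)"
      unfolding jac Z_d
      by (rule embn[of mul_lambda _ mul_mu, OF ad(1) Z_add(1)[of b] ad(2) mul_lambda_mu[symmetric]])
    show "jac_middle cbr a b (d c) = ?S (jac_middle cbr a b c) + ?D (jac_middle cbr a b c)"
      unfolding jac sesquilinearD(4)[OF f] out(2)[OF ad(1) Z_add(1)[of b]] Zd
      by (subst emb2, (intro ad additive_comp[OF ad(2)] additive_comp[OF D] Z_add)+)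
        (simp only: emb[of mul_lambda _ mul_mu, OF ad(1) Z_add(1)[of b] ad(2) mul_lambda_mu[symmetric]]
          emb[of mul_lambda _ "?D", OF ad(1) Z_add(1)[of b] D D_rules(4)] ac_simps)
  qed
  show "jacobiator cbr (d a) b c = - mul_lambda (jacobiator cbr a b c)"
    "jacobiator cbr a (d b) c = - mul_mu (jacobiator cbr a b c)"
    "jacobiator cbr a b (d c) =
      mul_lambda (jacobiator cbr a b c) + mul_mu (jacobiator cbr a b c) +
      map_poly (map_poly d) (jacobiator cbr a b c)"
    by (simp_all add: jacobiator_def outer_d inner_d middle_d ad_rules D_rules algebra_simps)
qed

lemma poly_generated_by_constants:
  fixes f :: "'a::ab_group_add poly \<Rightarrow> 'm::ab_group_add"
  assumes f: "additive f" and const: "\<And>a. f [:a:] = 0"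
    and shift: "\<And>p. f p = 0 \<Longrightarrow> f (pCons 0 p) = 0"
  shows "f p = 0"
proof (induction p)
  case 0
  show ?case by (rule additive.zero[OF f])
next
  case (pCons a p)
  then show ?case
    by (subst pCons_split) (simp only: additive.add[OF f] const shift add_0_left)
qed

lemma jacobiator_zero:
  assumes f: "sesquilinear (pCons 0) (pCons 0) (pCons 0) cbr"
    and const: "\<And>a b c. jacobiator cbr [:a:] [:b:] [:c:] = 0"
  shows "jacobiator cbr p q r = 0"
proof -
  note d = additive_pCons
  note z = additive.zero[OF additive_mul_lambda] additive.zero[OF additive_mul_mu]
  have 1: "jacobiator cbr [:a:] [:b:] r = 0" for a b
    by (rule poly_generated_by_constants[OF additive_jacobiator_3[OF f d]])
      (simp_all add: const jacobiator_d_3[OF f d] z)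
  have 2: "jacobiator cbr [:a:] q r = 0" for a
    by (rule poly_generated_by_constants[OF additive_jacobiator_2[OF f d]])
      (simp_all add: 1 jacobiator_d_2[OF f d] z)
  show ?thesis
    by (rule poly_generated_by_constants[OF additive_jacobiator_1[OF f d]])
      (simp_all add: 2 jacobiator_d_1[OF f d] z)
qed

section \<open>Scalars\<close>

lemma linear_imp_additive: "Vector_Spaces.linear s t f \<Longrightarrow> additive f"
  by (simp add: additive_def Vector_Spaces.linear_def module_hom_def module_hom_axioms_def)

lemma linearI:
  "vector_space s \<Longrightarrow> vector_space t \<Longrightarrow> additive f \<Longrightarrow> (\<And>c x. f (s c x) = t c (f x)) \<Longrightarrow>
   Vector_Spaces.linear s t f"
  by (simp add: Vector_Spaces.linear_def module_hom_def module_hom_axioms_def additive_def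
      module_iff_vector_space)

lemma vector_space_map_poly:
  assumes "vector_space s"
  shows "vector_space (\<lambda>c. map_poly (s c))"
proof -
  interpret vector_space s by fact
  show ?thesis
    by unfold_locales (auto intro!: poly_eqI simp: coeff_map_poly algebra_simps)
qed

lemma additive_scale: "vector_space s \<Longrightarrow> additive (s c)"
  by (simp add: additive_def vector_space_def)

lemma vector_space_kscale:
  assumes "module smul"
  shows "vector_space (kscale smul)"
proof -
  interpret module smul by fact
  have 1: "smul [:a:] (smul [:b:] x) = smul [:a * b:] x" for a b x
    by (simp add: mult_ac)
  have 2: "smul [:a + b:] x = smul [:a:] x + smul [:b:] x" for a b x
    by (metis add_pCons add_0 scale_left_distrib)
  have 3: "smul [:1:] x = x" for x
    by (metis one_pCons scale_one)
  show ?thesis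
    by unfold_locales (simp_all add: kscale_def 1 2 3 scale_right_distrib del: scale_scale)
qed

lemma vector_space_kscale_poly: "module smul \<Longrightarrow> vector_space (kscale_poly smul)"
  unfolding kscale_poly_def[abs_def] by (intro vector_space_map_poly vector_space_kscale)

lemma additive_dact: "module smul \<Longrightarrow> additive (dact smul)"
  by (simp add: additive_def dact_def module_def)

text \<open>Both module structures of the development are of this shape: \<open>\<partial>\<close> is the shift of coefficients on
  \<open>k[\<partial>]V\<close>, and multiplication by \<open>-\<lambda>\<close> on the values of the maps in \<open>gc(M)\<close>.\<close>

lemma module_poly_subst:
  fixes t :: "'k::field \<Rightarrow> 'm::ab_group_add \<Rightarrow> 'm"
  assumes t: "vector_space t" and T: "additive T" and tT: "\<And>c x. T (t c x) = t c (T x)"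
  shows "module (\<lambda>p x. poly_subst T (\<lambda>c. t c x) p)"
proof -
  interpret vector_space t by fact
  let ?s = "\<lambda>p x. poly_subst T (\<lambda>c. t c x) p"
  have t_add: "additive (\<lambda>c. t c x)" "additive (t c)" for x c
    by (simp_all add: additive_def scale_left_distrib scale_right_distrib)
  have smult: "?s (smult c p) x = t c (?s p x)" for c p x
    by (induction p) (simp_all add: poly_subst_pCons T tT scale_right_distrib)
  show ?thesis
  proof
    fix p q x y
    show "?s p (x + y) = ?s p x + ?s p y"
      by (simp add: scale_right_distrib poly_subst_add_embed T)
    show "?s (p + q) x = ?s p x + ?s q x"
      by (intro poly_subst_add T t_add)
    show "?s p (?s q x) = ?s (p * q) x"
      by (induction p)
        (simp_all add: poly_subst_pCons T poly_subst_add t_add smult)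
    show "?s 1 x = x"
      by (simp add: one_pCons poly_subst_pCons T additive.zero[OF T])
  qed
qed

lemma module_pointwise:
  assumes "module s"
  shows "module (\<lambda>c f v. s c (f v))"
proof -
  interpret module s by fact
  show ?thesis by unfold_locales (auto simp: fun_eq_iff algebra_simps)
qed

lemma module_free_smul: "vector_space s \<Longrightarrow> module (free_smul s)"
  unfolding free_smul_def[abs_def]
  by (intro module_poly_subst vector_space_map_poly additive_pCons)
    (simp_all add: map_poly_pCons_0 additive_scale)

lemma kscale_free_smul: "vector_space s \<Longrightarrow> kscale (free_smul s) c = map_poly (s c)"
  by (simp add: fun_eq_iff kscale_def free_smul_def poly_subst_pCons additive_pCons
      module.scale_zero_left[OF module_iff_vector_space[THEN iffD2, OF vector_space_map_poly]])

lemma dact_free_smul: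
  assumes "vector_space s"
  shows "dact (free_smul s) = pCons 0"
proof -
  interpret vector_space "\<lambda>c. map_poly (s c)" by (rule vector_space_map_poly[OF assms])
  show ?thesis
    by (simp add: fun_eq_iff dact_def free_smul_def poly_subst_pCons additive_pCons)
qed

lemma module_gc_scale: "module smul \<Longrightarrow> module (gc_scale smul)"
  unfolding gc_scale_def[abs_def]
  by (intro module_pointwise module_poly_subst vector_space_kscale_poly additive_uminus
      additive_lam)
    (simp_all add: kscale_poly_def map_poly_lam additive_scale vector_space_kscale
      additive.minus[OF additive_map_poly])

lemma bilinear_map_additive:
  assumes "bilinear_map sU sV sW f"
  shows "additive (f u)" "additive (\<lambda>u. f u v)"
  using assms by (auto simp: bilinear_map_def intro: linear_imp_additive)

lemma bilinear_map_scale: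
  assumes "bilinear_map sU sV sW f"
  shows "f (sU c u) v = sW c (f u v)" "f u (sV c v) = sW c (f u v)"
  using assms by (simp_all add: bilinear_map_def Vector_Spaces.linear_def module_hom_def module_hom_axioms_def)

lemma bilinear_mapI:
  assumes "vector_space sU" "vector_space sV" "vector_space sW"
    and "\<And>u. additive (f u)" "\<And>v. additive (\<lambda>u. f u v)"
    and "\<And>c u v. f (sU c u) v = sW c (f u v)" "\<And>c u v. f u (sV c v) = sW c (f u v)"
  shows "bilinear_map sU sV sW f"
  using assms by (simp add: bilinear_map_def linearI)

text \<open>In this form the two products on \<open>A\<close> and the maps \<open>l\<close>, \<open>r\<close>, \<open>\<rho>\<close> become instances of the same
  hypothesis.\<close>

lemma linear_into_End_bilinear:
  assumes "linear_into_End sA sV l" "vector_space sA" "vector_space sV"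
  shows "bilinear_map sA sV sV l"
proof (rule bilinear_mapI)
  have l: "Vector_Spaces.linear sV sV (l a)" for a
    using assms by (simp add: linear_into_End_def)
  interpret L: Vector_Spaces.linear sA "\<lambda>c f v. sV c (f v)" l
    using assms by (simp add: linear_into_End_def)
  show "additive (l a)" for a by (rule linear_imp_additive[OF l])
  show "l u (sV c v) = sV c (l u v)" for u c v
    using l[of u] by (simp add: Vector_Spaces.linear_def module_hom.scale)
  show "additive (\<lambda>a. l a v)" for v by (simp add: additive_def L.add)
  show "l (sA c u) v = sV c (l u v)" for u c v by (simp add: L.scale)
qed (use assms in auto)

section \<open>Sesquilinear extensions of bilinear maps\<close>

text \<open>Homogeneity under scalars is proved by uniqueness: multiplying by \<open>c\<close> before or after the map
  gives sesquilinear maps, which agree on generators.\<close>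

lemma
  fixes sA :: "'k::field_char_0 \<Rightarrow> 'a::ab_group_add \<Rightarrow> 'a"
    and sV :: "'k \<Rightarrow> 'v::ab_group_add \<Rightarrow> 'v"
  assumes A: "vector_space sA" and V: "vector_space sV"
    and l: "bilinear_map sA sV sV l" and r: "bilinear_map sA sV sV r"
    and \<rho>: "bilinear_map sA sV sV \<rho>"
  shows sesquilinear_gd_rep: "sesquilinear (pCons 0) (pCons 0) (pCons 0) (gd_rep l r \<rho>)"
    and gd_rep_const: "gd_rep l r \<rho> [:a:] [:v:] = [:[:\<rho> a v, r a v:], [:l a v + r a v:]:]"
    and bilinear_gd_rep: "bilinear_map (kscale (free_smul sA)) (kscale (free_smul sV))
      (kscale_poly (free_smul sV)) (gd_rep l r \<rho>)"
proof -
  note add = bilinear_map_additive[OF l] bilinear_map_additive[OF r] bilinear_map_additive[OF \<rho>]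
  define g where "g a v = [:[:\<rho> a v, r a v:], [:l a v + r a v:]:]" for a v
  have g: "additive (g a)" "additive (\<lambda>a. g a v)" for a v
    by (auto simp: additive_def g_def additive.add[OF add(1)] additive.add[OF add(2)]
        additive.add[OF add(3)] additive.add[OF add(4)] additive.add[OF add(5)]
        additive.add[OF add(6)])
  have rep: "gd_rep l r \<rho> = sesqui_extend g"
    by (simp add: gd_rep_def g_def[abs_def])
  show ses: "sesquilinear (pCons 0) (pCons 0) (pCons 0) (gd_rep l r \<rho>)"
    unfolding rep by (intro sesquilinear_sesqui_extend g)
  show const: "gd_rep l r \<rho> [:a:] [:v:] = [:[:\<rho> a v, r a v:], [:l a v + r a v:]:]" for a v
    unfolding rep by (simp add: sesqui_extend_const g) (simp add: g_def)
  note addA = additive_scale[OF A] and addV = additive_scale[OF V]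
  have zero: "sA c 0 = 0" "sV c 0 = 0" for c
    by (rule additive.zero[OF addA] additive.zero[OF addV])+
  have target: "sesquilinear (pCons 0) (pCons 0) (pCons 0)
      (\<lambda>p q. map_poly (map_poly (sV c)) (gd_rep l r \<rho> p q))" for c
    by (rule sesquilinear_comp[OF ses, where g = "\<lambda>x. x" and h = "\<lambda>x. x"])
      (auto simp: map_poly_pCons_0 addV additive_map_poly additive_pCons intro: additive.intro)
  have left: "sesquilinear (pCons 0) (pCons 0) (pCons 0)
      (\<lambda>p q. gd_rep l r \<rho> (map_poly (sA c) p) q)" for c
    using sesquilinear_comp[OF ses, where g = "map_poly (sA c)" and h = "\<lambda>x. x" and k = "\<lambda>x. x"
        and dR' = "pCons 0" and dS' = "pCons 0" and dM' = "pCons 0"]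
    by (auto simp: map_poly_pCons_0 addA additive_map_poly additive_pCons intro: additive.intro)
  have right: "sesquilinear (pCons 0) (pCons 0) (pCons 0)
      (\<lambda>p q. gd_rep l r \<rho> p (map_poly (sV c) q))" for c
    using sesquilinear_comp[OF ses, where h = "map_poly (sV c)" and g = "\<lambda>x. x" and k = "\<lambda>x. x"
        and dR' = "pCons 0" and dS' = "pCons 0" and dM' = "pCons 0"]
    by (auto simp: map_poly_pCons_0 addV additive_map_poly additive_pCons intro: additive.intro)
  show "bilinear_map (kscale (free_smul sA)) (kscale (free_smul sV))
      (kscale_poly (free_smul sV)) (gd_rep l r \<rho>)"
  proof (rule bilinear_mapI)
    show "gd_rep l r \<rho> (kscale (free_smul sA) c p) q =
        kscale_poly (free_smul sV) c (gd_rep l r \<rho> p q)" for c p q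
      unfolding kscale_poly_def kscale_free_smul[OF A] kscale_free_smul[OF V]
      by (rule sesquilinear_unique[OF left target])
        (simp add: map_poly_pCons zero const bilinear_map_scale[OF l] bilinear_map_scale[OF r]
          bilinear_map_scale[OF \<rho>] additive.add[OF addV])
    show "gd_rep l r \<rho> p (kscale (free_smul sV) c q) =
        kscale_poly (free_smul sV) c (gd_rep l r \<rho> p q)" for c p q
      unfolding kscale_poly_def kscale_free_smul[OF V]
      by (rule sesquilinear_unique[OF right target])
        (simp add: map_poly_pCons zero const bilinear_map_scale[OF l] bilinear_map_scale[OF r]
          bilinear_map_scale[OF \<rho>] additive.add[OF addV])
  qed (use sesquilinearD[OF ses] in
      \<open>auto intro: vector_space_kscale vector_space_kscale_poly module_free_smul A V\<close>)
qed

text \<open>The law for the second argument is membership in \<open>gc(M)\<close>. The law for the first argument says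
  that \<open>\<partial>\<close> is respected, and with homogeneity under scalars this extends to all of \<open>k[\<partial>]\<close>.\<close>

lemma gc_module_hom_sesquilinear:
  assumes R: "module smulR" and M: "module smulM"
    and ses: "sesquilinear (dact smulR) (dact smulM) (dact smulM) \<rho>"
    and bil: "bilinear_map (kscale smulR) (kscale smulM) (kscale_poly smulM) \<rho>"
  shows "gc_module_hom smulR smulM \<rho>"
proof -
  interpret R: module smulR by fact
  have "\<rho> (smulR p x) = gc_scale smulM p (\<rho> x)" for p x
  proof (rule ext)
    fix v
    interpret K: vector_space "kscale_poly smulM" by (rule vector_space_kscale_poly[OF M])
    show "\<rho> (smulR p x) v = gc_scale smulM p (\<rho> x) v"
    proof (induction p)
      case 0
      then show ?case by (simp add: sesquilinear_0[OF ses] gc_scale_def)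
    next
      case (pCons c p)
      have "smulR (pCons c p) x = kscale smulR c x + dact smulR (smulR p x)"
        by (simp add: kscale_def dact_def flip: R.scale_left_distrib)
      then show ?case
        by (simp add: additive.add[OF sesquilinearD(2)[OF ses]] sesquilinearD(3)[OF ses]
            bilinear_map_scale[OF bil] pCons gc_scale_def poly_subst_pCons additive_uminus
            additive_lam)
    qed
  qed
  moreover have "\<rho> (x + y) = \<rho> x + \<rho> y" for x y
    by (simp add: fun_eq_iff additive.add[OF sesquilinearD(2)[OF ses]])
  ultimately have "module_hom smulR (gc_scale smulM) \<rho>"
    using R M by (simp add: module_hom_def module_hom_axioms_def module_gc_scale)
  moreover have "\<rho> a \<in> gc smulM" for a
    using bil by (simp add: gc_def bilinear_map_def sesquilinearD(4)[OF ses] dact_poly_def)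
  ultimately show ?thesis
    by (auto simp: gc_module_hom_def)
qed

lemma lie_conformal_algebra_iff:
  "lie_conformal_algebra smul cbr \<longleftrightarrow>
     module smul \<and> bilinear_map (kscale smul) (kscale smul) (kscale_poly smul) cbr \<and>
     sesquilinear (dact smul) (dact smul) (dact smul) cbr \<and>
     (\<forall>a b. cbr a b = - reflect (dact smul) (cbr b a)) \<and>
     (\<forall>a b c. jacobiator cbr a b c = 0)"
  unfolding lie_conformal_algebra_def lie_conformal_algebra_axioms_def sesquilinear_def
    jacobiator_def jac_outer_def jac_inner_def jac_middle_def dact_poly_def neg_lam_d_def
    reflect_def diff_diff_eq right_minus_eq
  by (auto dest: bilinear_map_additive)

section \<open>Lie conformal algebras of Gel'fand-Dorfman algebras\<close>

lemma bilinear_map_flip: "bilinear_map sU sV sW f \<Longrightarrow> bilinear_map sV sU sW (\<lambda>u v. f v u)"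
  by (simp add: bilinear_map_def)

text \<open>The bracket is the adjoint action: \<open>l\<close> and \<open>r\<close> are the left and right multiplications.\<close>

lemma gd_cbr_eq_gd_rep: "gd_cbr circ br = gd_rep circ (\<lambda>a b. circ b a) br"
  by (simp add: gd_cbr_def gd_rep_def)

lemma reflect_generator:
  "reflect (pCons 0) [:[:u, v:], [:w:]:] = [:[:u, v - w:], [:- w:]:]"
  for u :: "'a::ab_group_add"
proof -
  note T = additive_reflect_operator[OF additive_pCons]
  show ?thesis
    by (simp add: reflect_def poly_subst_pCons[OF T] additive.zero[OF T])
      (simp add: lam_def map_poly_pCons)
qed

lemma
  fixes s :: "'k::field_char_0 \<Rightarrow> 'a::ab_group_add \<Rightarrow> 'a"
  assumes s: "vector_space s" and circ: "bilinear_map s s s circ" and br: "bilinear_map s s s br"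
  shows sesquilinear_gd_cbr: "sesquilinear (pCons 0) (pCons 0) (pCons 0) (gd_cbr circ br)"
    and gd_cbr_const: "gd_cbr circ br [:a:] [:b:] = [:[:br a b, circ b a:], [:circ a b + circ b a:]:]"
    and bilinear_gd_cbr: "bilinear_map (kscale (free_smul s)) (kscale (free_smul s))
      (kscale_poly (free_smul s)) (gd_cbr circ br)"
  unfolding gd_cbr_eq_gd_rep
  by (rule sesquilinear_gd_rep[OF s s] gd_rep_const[OF s s] bilinear_gd_rep[OF s s]
      circ br bilinear_map_flip)+

text \<open>The three terms of the Jacobi identity on generators. In the nested lists the outermost level
  counts powers of \<open>\<mu>\<close>, the next one powers of \<open>\<lambda>\<close>, and the innermost one powers of \<open>\<partial>\<close>; \<open>st\<close> is the
  symmetrised product \<open>a \<star> b\<close>.\<close>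

lemma
  fixes s :: "'k::field_char_0 \<Rightarrow> 'a::ab_group_add \<Rightarrow> 'a"
  assumes s: "vector_space s" and circ: "bilinear_map s s s circ" and br: "bilinear_map s s s br"
  defines "st \<equiv> \<lambda>a b. circ a b + circ b a"
  shows jac_outer_const: "jac_outer (gd_cbr circ br) [:a:] [:b:] [:c:] =
      [: [: [:br a (br b c), br a (circ c b) + circ (br b c) a, circ (circ c b) a:],
            [:br a (circ c b) + st a (br b c), circ (circ c b) a + st a (circ c b):],
            [:st a (circ c b):] :],
         [: [:br a (st b c), circ (st b c) a:],
            [:st a (st b c):] :] :]"
    and jac_inner_const: "jac_inner (gd_cbr circ br) [:a:] [:b:] [:c:] =
      [: [: [:br (br a b) c, circ c (br a b):],
            [:br (circ a b) c + st (br a b) c, circ c (circ a b):],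
            [:st (circ a b) c:] :],
         [: [:st (br a b) c - br (circ b a) c, - circ c (circ b a):],
            [:st (circ a b) c - st (circ b a) c:] :],
         [: [:- st (circ b a) c:] :] :]"
    and jac_middle_const: "jac_middle (gd_cbr circ br) [:a:] [:b:] [:c:] =
      [: [: [:br b (br a c), br b (circ c a) + circ (br a c) b, circ (circ c a) b:],
            [:br b (st a c), circ (st a c) b:] :],
         [: [:br b (circ c a) + st b (br a c), circ (circ c a) b + st b (circ c a):],
            [:st b (st a c):] :],
         [: [:st b (circ c a):] :] :]"
proof -
  let ?F = "gd_cbr circ br"
  note ses = sesquilinear_gd_cbr[OF s circ br] and const = gd_cbr_const[OF s circ br]
  note z0 = sesquilinear_0[OF ses]
  note ad = additive_mul_lambda additive_mul_mu additive_lambda_plus_mu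
  note add_circ = bilinear_map_additive[OF circ] and add_br = bilinear_map_additive[OF br]
  note lin = additive.add[OF add_circ(1)] additive.add[OF add_circ(2)]
    additive.add[OF add_br(1)] additive.add[OF add_br(2)]
    additive.diff[OF add_circ(1)] additive.diff[OF add_circ(2)]
    additive.diff[OF add_br(1)] additive.diff[OF add_br(2)]
  have right: "?F [:x:] [:u, v:] =
      [: [:br x u, br x v + circ u x, circ v x:], [:st x u + br x v, circ v x + st x v:],
         [:st x v:] :]" for x u v
  proof -
    have "?F [:x:] [:u, v:] = ?F [:x:] [:u:] + (lam (?F [:x:] [:v:]) +
        map_poly (pCons 0) (?F [:x:] [:v:]))"
      by (subst pCons_split)
        (simp only: additive.add[OF sesquilinearD(1)[OF ses]] sesquilinearD(4)[OF ses])
    then show ?thesis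
      by (simp add: const lam_def map_poly_pCons st_def ac_simps)
  qed
  have left: "?F [:u, v:] [:x:] =
      [: [:br u x, circ x u:], [:st u x - br v x, - circ x v:], [:- st v x:] :]" for x u v
  proof -
    have "?F [:u, v:] [:x:] = ?F [:u:] [:x:] - lam (?F [:v:] [:x:])"
      by (subst pCons_split)
        (simp only: additive.add[OF sesquilinearD(2)[OF ses]] sesquilinearD(3)[OF ses]
          add_uminus_conv_diff)
    then show ?thesis
      by (simp add: const lam_def st_def)
  qed
  note ev = poly_subst_pCons ad z0 additive.zero[OF ad(1)] additive.zero[OF ad(2)]
    additive.zero[OF additive_const2] poly_subst_0
  have shift: "map_poly (pCons 0) (pCons p q) = pCons (pCons 0 p) (map_poly (pCons 0) q)"
    for p :: "'a poly poly" and q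
    by (simp add: map_poly_pCons)
  note mul = mul_lambda_def mul_mu_def const2_def shift map_poly_0 add_pCons add_0_left add_0_right
  show "jac_outer (gd_cbr circ br) [:a:] [:b:] [:c:] =
      [: [: [:br a (br b c), br a (circ c b) + circ (br b c) a, circ (circ c b) a:],
            [:br a (circ c b) + st a (br b c), circ (circ c b) a + st a (circ c b):],
            [:st a (circ c b):] :],
         [: [:br a (st b c), circ (st b c) a:],
            [:st a (st b c):] :] :]"
    unfolding jac_outer_def const by (simp only: ev right const add_0_right) (simp only: mul st_def lin pCons_eq_iff, simp add: ac_simps)
  show "jac_inner (gd_cbr circ br) [:a:] [:b:] [:c:] =
      [: [: [:br (br a b) c, circ c (br a b):],
            [:br (circ a b) c + st (br a b) c, circ c (circ a b):],
            [:st (circ a b) c:] :],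
         [: [:st (br a b) c - br (circ b a) c, - circ c (circ b a):],
            [:st (circ a b) c - st (circ b a) c:] :],
         [: [:- st (circ b a) c:] :] :]"
    unfolding jac_inner_def const
    by (simp only: ev left const add_0_right) (simp only: mul st_def lin pCons_eq_iff, simp add: algebra_simps)
  show "jac_middle (gd_cbr circ br) [:a:] [:b:] [:c:] =
      [: [: [:br b (br a c), br b (circ c a) + circ (br a c) b, circ (circ c a) b:],
            [:br b (st a c), circ (st a c) b:] :],
         [: [:br b (circ c a) + st b (br a c), circ (circ c a) b + st b (circ c a):],
            [:st b (st a c):] :],
         [: [:st b (circ c a):] :] :]"
    unfolding jac_middle_def const by (simp only: ev right const add_0_right) (simp only: mul st_def lin pCons_eq_iff, simp add: ac_simps)
qed

text \<open>The coefficients of \<open>1\<close>, \<open>\<partial>\<close> and \<open>\<partial>\<^sup>2\<close> in the Jacobi identity are the Jacobi identity of the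
  Lie bracket, the compatibility condition, and right commutativity; left symmetry comes from
  \<open>\<lambda>\<partial>\<close> with the help of right commutativity. For the converse the axioms are oriented as rewrite rules
  that bring every coefficient to a normal form.\<close>

theorem lie_conformal_gd_iff:
  fixes s :: "'k::field_char_0 \<Rightarrow> 'a::ab_group_add \<Rightarrow> 'a"
  assumes s: "vector_space s" and circ: "bilinear_map s s s circ" and br: "bilinear_map s s s br"
  shows "lie_conformal_algebra (free_smul s) (gd_cbr circ br) \<longleftrightarrow> gd_algebra s circ br"
    (is "?lhs \<longleftrightarrow> ?rhs")
proof -
  note ses = sesquilinear_gd_cbr[OF s circ br] and const = gd_cbr_const[OF s circ br]
  note jac = jac_outer_const[OF s circ br] jac_inner_const[OF s circ br]
    jac_middle_const[OF s circ br]
  note add_circ = bilinear_map_additive[OF circ] and add_br = bilinear_map_additive[OF br]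
  note lin = additive.add[OF add_circ(1)] additive.add[OF add_circ(2)]
    additive.add[OF add_br(1)] additive.add[OF add_br(2)]
    additive.minus[OF add_circ(1)] additive.minus[OF add_circ(2)]
    additive.minus[OF add_br(1)] additive.minus[OF add_br(2)]
  show ?thesis
  proof
    assume ?lhs
    then have L_skew: "gd_cbr circ br p q = - reflect (pCons 0) (gd_cbr circ br q p)"
      and L_jac: "jacobiator (gd_cbr circ br) p q r = 0" for p q r
      unfolding lie_conformal_algebra_iff dact_free_smul[OF s] by blast+
    have anti: "br a b = - br b a" for a b
      using L_skew[of "[:a:]" "[:b:]"] by (simp add: const reflect_generator)
    have J: "jac_outer (gd_cbr circ br) [:a:] [:b:] [:c:] =
        jac_inner (gd_cbr circ br) [:a:] [:b:] [:c:] + jac_middle (gd_cbr circ br) [:a:] [:b:] [:c:]"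
      for a b c
      using L_jac[of "[:a:]" "[:b:]" "[:c:]"] by (simp add: jacobiator_def algebra_simps)
    have coeff_1: "br a (br b c) = br (br a b) c + br b (br a c)" for a b c
      using arg_cong[OF J[of a b c], of "\<lambda>p. coeff (coeff (coeff p 0) 0) 0"]
      unfolding jac by simp
    have coeff_d: "br a (circ c b) + circ (br b c) a =
        circ c (br a b) + (br b (circ c a) + circ (br a c) b)" for a b c
      using arg_cong[OF J[of a b c], of "\<lambda>p. coeff (coeff (coeff p 0) 0) 1"]
      unfolding jac by simp
    have coeff_dd: "circ (circ c b) a = circ (circ c a) b" for a b c
      using arg_cong[OF J[of a b c], of "\<lambda>p. coeff (coeff (coeff p 0) 0) 2"]
      unfolding jac by (simp add: numeral_2_eq_2)
    have coeff_lambda_d: "circ (circ c b) a + (circ a (circ c b) + circ (circ c b) a) =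
        circ c (circ a b) + (circ (circ a c) b + circ (circ c a) b)" for a b c
      using arg_cong[OF J[of a b c], of "\<lambda>p. coeff (coeff (coeff p 0) 1) 1"]
      unfolding jac by (simp add: lin)
    show ?rhs
    proof (intro gd_algebra.intro novikov_algebra.intro lie_algebra.intro
        novikov_algebra_axioms.intro lie_algebra_axioms.intro gd_algebra_axioms.intro s circ br)
      fix a b c
      show "circ (circ a b) c = circ (circ a c) b" by (rule coeff_dd)
      show "circ (circ a b) c - circ a (circ b c) = circ (circ b a) c - circ b (circ a c)"
        using coeff_lambda_d[of a c b] coeff_dd[of a c b] by (simp add: algebra_simps)
      show "br a a = 0"
      proof -
        interpret vector_space s by (rule s)
        \<comment> \<open>Antisymmetry gives the alternating law because the scalar \<open>2\<close> is invertible.\<close>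
        have "s 2 (br a a) = br a a + br a a"
          by (metis one_add_one scale_left_distrib scale_one)
        also have "\<dots> = 0"
          using anti[of a a] by (metis add.right_inverse)
        finally show ?thesis by simp
      qed
      show "br a (br b c) + br b (br c a) + br c (br a b) = 0"
        using coeff_1[of a b c] anti[of "br a b" c] anti[of a c] by (simp add: lin)
      show "br (circ a b) c - br (circ a c) b + circ (br a b) c - circ (br a c) b - circ a (br b c) = 0"
        using coeff_d[of b a c] anti[of "circ a b" c] anti[of "circ a c" b] anti[of a b] anti[of a c]
        by (simp add: lin algebra_simps)
    qed
  next
    assume R: ?rhs
    interpret gd_algebra s circ br by (rule R)
    have anti: "br a b = - br b a" for a b
    proof -
      have "br (a + b) (a + b) = br a b + br b a"
        unfolding lin by (simp add: br_alternating)
      then show ?thesis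
        by (metis br_alternating eq_neg_iff_add_eq_0)
    qed
    have skew: "gd_cbr circ br p q = - reflect (pCons 0) (gd_cbr circ br q p)" for p q
      by (rule sesquilinear_unique[OF ses sesquilinear_swap[OF ses additive_pCons]])
        (simp add: const reflect_generator anti[symmetric])
    have jac0: "jacobiator (gd_cbr circ br) [:a:] [:b:] [:c:] = 0" for a b c
    proof -
      have anti_rules: "br b (br a c) = - br b (br c a)" "br (br a b) c = - br c (br a b)"
        by (subst anti[of a c], simp only: lin) (rule anti)
      have jacobi: "br a (br b c) = - br b (br c a) - br c (br a b)"
        using br_jacobi[of a b c] by (simp add: algebra_simps eq_neg_iff_add_eq_0)
      \<comment> \<open>The normal form: of two equal products \<open>(xy)z\<close>, the one among \<open>(ab)c\<close>, \<open>(ba)c\<close>, \<open>(ca)b\<close>; no products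
          \<open>a(bc)\<close>, \<open>a(cb)\<close>, \<open>b(ca)\<close>; products inside a Lie bracket on the left; no brackets \<open>[ca, b]\<close>,
          \<open>[ab, c]\<close>, \<open>[ba, c]\<close>.\<close>
      have rc: "circ (circ a c) b = circ (circ a b) c" "circ (circ b c) a = circ (circ b a) c"
        "circ (circ c b) a = circ (circ c a) b"
        by (rule right_commutative)+
      have ls: "circ a (circ b c) = circ b (circ a c) + circ (circ a b) c - circ (circ b a) c"
        "circ a (circ c b) = circ c (circ a b) + circ (circ a b) c - circ (circ c a) b"
        "circ b (circ c a) = circ c (circ b a) + circ (circ b a) c - circ (circ c a) b"
        using left_symmetric[of a b c] left_symmetric[of a c b] left_symmetric[of b c a]
        by (simp_all add: rc algebra_simps)
      have swap: "br a (circ b c) = - br (circ b c) a" "br a (circ c b) = - br (circ c b) a"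
        "br b (circ a c) = - br (circ a c) b" "br b (circ c a) = - br (circ c a) b"
        by (rule anti)+
      have gd: "br (circ c a) b = br (circ c b) a + circ (br a c) b - circ (br b c) a + circ c (br a b)"
        "br (circ a b) c = br (circ a c) b - circ (br a b) c + circ (br a c) b + circ a (br b c)"
        "br (circ b a) c = br (circ b c) a + circ (br a b) c + circ (br b c) a + circ b (br a c)"
        using gd_compatible[of c a b] gd_compatible[of a b c] gd_compatible[of b a c]
          anti[of c a] anti[of c b] anti[of b a]
        by (simp_all add: lin algebra_simps)
      show ?thesis
        unfolding jacobiator_def diff_diff_eq right_minus_eq jac
        by (simp only: lin add_pCons pCons_eq_iff add_0_left add_0_right anti_rules jacobi rc ls swap gd)
          (simp add: algebra_simps)
    qed
    show ?lhs
      unfolding lie_conformal_algebra_iff dact_free_smul[OF s]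
      using skew jacobiator_zero[OF ses jac0] ses bilinear_gd_cbr[OF s circ br]
        module_free_smul[OF s] by blast
  qed
qed

section \<open>Transport along isomorphisms\<close>

lemma jacobiator_transport:
  assumes \<phi>: "additive \<phi>"
    and f: "\<And>a. additive (f a)" "\<And>b. additive (\<lambda>a. f a b)"
    and g: "\<And>a. additive (g a)" "\<And>b. additive (\<lambda>a. g a b)"
    and fg: "\<And>a b. g (\<phi> a) (\<phi> b) = map_poly \<phi> (f a b)"
  shows "jacobiator g (\<phi> a) (\<phi> b) (\<phi> c) = map_poly (map_poly \<phi>) (jacobiator f a b c)"
proof -
  let ?\<Phi> = "map_poly (map_poly \<phi>)"
  note ad = additive_mul_lambda additive_mul_mu additive_lambda_plus_mu
  have \<Phi>: "additive ?\<Phi>" by (intro additive_map_poly \<phi>)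
  have push: "?\<Phi> (poly_subst T e p) = poly_subst T' e' (map_poly \<phi> p)"
    if "additive T" "additive T'" "\<And>x. ?\<Phi> (T x) = T' (?\<Phi> x)" "additive e" "additive e'"
      "\<And>r. ?\<Phi> (e r) = e' (\<phi> r)" for T T' e e' p
    using that
    by (simp add: poly_subst_intertwine[OF _ _ \<Phi>, of T T'] additive.zero poly_subst_map_poly \<phi>)
  have inner: "?\<Phi> (poly_subst T const2 p) = poly_subst T' const2 (map_poly \<phi> p)"
    if "additive T" "additive T'" "\<And>x. ?\<Phi> (T x) = T' (?\<Phi> x)" for T T' p
    by (rule push[OF that additive_const2 additive_const2]) (rule coefficientwise_mul[OF \<phi>])
  have sum: "?\<Phi> (mul_lambda x + mul_mu x) = mul_lambda (?\<Phi> x) + mul_mu (?\<Phi> x)" for x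
    by (simp add: additive.add[OF \<Phi>] coefficientwise_mul[OF \<phi>])
  note mul = ad(1)[THEN inner, OF ad(1) coefficientwise_mul(1)[OF \<phi>]]
    ad(2)[THEN inner, OF ad(2) coefficientwise_mul(2)[OF \<phi>]] inner[OF ad(3) ad(3) sum]
  have "?\<Phi> (jac_outer f a b c) = jac_outer g (\<phi> a) (\<phi> b) (\<phi> c)"
    unfolding jac_outer_def fg
    by (rule push)
      (intro ad coefficientwise_mul[OF \<phi>] additive_comp[OF additive_evaluation] f g | simp add: mul fg)+
  moreover have "?\<Phi> (jac_inner f a b c) = jac_inner g (\<phi> a) (\<phi> b) (\<phi> c)"
    unfolding jac_inner_def fg
    by (rule push)
      (intro ad coefficientwise_mul[OF \<phi>] additive_comp[OF additive_evaluation] f g | simp add: mul fg)+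
  moreover have "?\<Phi> (jac_middle f a b c) = jac_middle g (\<phi> a) (\<phi> b) (\<phi> c)"
    unfolding jac_middle_def fg
    by (rule push)
      (intro ad coefficientwise_mul[OF \<phi>] additive_comp[OF additive_evaluation] f g | simp add: mul fg)+
  ultimately show ?thesis
    by (simp add: jacobiator_def additive.diff[OF \<Phi>])
qed

text \<open>Every axiom is an identity between expressions that \<open>\<phi>\<close> carries over, so the image of a Lie
  conformal algebra is one. Surjectivity guarantees that all of the target is reached.\<close>

lemma lie_conformal_transport:
  assumes L: "lie_conformal_algebra smul cbr" and M: "module smul'"
    and \<phi>: "additive \<phi>" "\<And>p x. \<phi> (smul p x) = smul' p (\<phi> x)" "surj \<phi>"
    and hom: "\<And>x y. cbr' (\<phi> x) (\<phi> y) = map_poly \<phi> (cbr x y)"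
  shows "lie_conformal_algebra smul' cbr'"
proof -
  have mod: "module smul" and bil: "bilinear_map (kscale smul) (kscale smul) (kscale_poly smul) cbr"
    and ses: "sesquilinear (dact smul) (dact smul) (dact smul) cbr"
    and skew: "\<And>a b. cbr a b = - reflect (dact smul) (cbr b a)"
    and jac: "\<And>a b c. jacobiator cbr a b c = 0"
    using L unfolding lie_conformal_algebra_iff by blast+
  have ex: "\<exists>x. a = \<phi> x" for a
    using \<phi>(3) by (auto simp: surj_def)
  note \<phi>_add = additive.add[OF \<phi>(1), symmetric]
  have \<phi>_d: "\<phi> (dact smul x) = dact smul' (\<phi> x)" for x
    by (simp add: dact_def \<phi>)
  have \<phi>_k: "\<phi> (kscale smul c x) = kscale smul' c (\<phi> x)" for c x
    by (simp add: kscale_def \<phi>)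
  note d = additive_dact[OF mod] additive_dact[OF M]
  have map_d: "map_poly \<phi> (map_poly (dact smul) p) = map_poly (dact smul') (map_poly \<phi> p)" for p
    by (simp add: map_poly_map_poly additive.zero d \<phi>(1) o_def \<phi>_d)
  have map_k: "map_poly \<phi> (kscale_poly smul c p) = kscale_poly smul' c (map_poly \<phi> p)" for c p
    by (simp add: kscale_poly_def map_poly_map_poly additive.zero additive_scale vector_space_kscale
        mod M \<phi>(1) o_def \<phi>_k)
  have add: "additive (cbr' a)" "additive (\<lambda>a. cbr' a b)" for a b
  proof -
    show "additive (cbr' a)"
      unfolding additive_def
    proof (intro allI)
      fix b c
      obtain x y z where "a = \<phi> x" "b = \<phi> y" "c = \<phi> z" using ex by metis
      then show "cbr' a (b + c) = cbr' a b + cbr' a c"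
        by (simp add: \<phi>_add hom additive.add[OF sesquilinearD(1)[OF ses]] map_poly_add \<phi>(1))
    qed
    show "additive (\<lambda>a. cbr' a b)"
      unfolding additive_def
    proof (intro allI)
      fix a c
      obtain x y z where "a = \<phi> x" "b = \<phi> y" "c = \<phi> z" using ex by metis
      then show "cbr' (a + c) b = cbr' a b + cbr' c b"
        by (simp add: \<phi>_add hom additive.add[OF sesquilinearD(2)[OF ses]] map_poly_add \<phi>(1))
    qed
  qed
  show ?thesis
    unfolding lie_conformal_algebra_iff
  proof (intro conjI allI M)
    show "bilinear_map (kscale smul') (kscale smul') (kscale_poly smul') cbr'"
    proof (intro bilinear_mapI vector_space_kscale vector_space_kscale_poly M add)
      fix c a b
      obtain x y where "a = \<phi> x" "b = \<phi> y" using ex by metis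
      then show "cbr' (kscale smul' c a) b = kscale_poly smul' c (cbr' a b)"
        "cbr' a (kscale smul' c b) = kscale_poly smul' c (cbr' a b)"
        by (simp_all add: hom bilinear_map_scale[OF bil] map_k flip: \<phi>_k)
    qed
    show "sesquilinear (dact smul') (dact smul') (dact smul') cbr'"
      unfolding sesquilinear_def
    proof (intro conjI allI add)
      fix a b
      obtain x y where "a = \<phi> x" "b = \<phi> y" using ex by metis
      then show "cbr' (dact smul' a) b = - lam (cbr' a b)"
        "cbr' a (dact smul' b) = lam (cbr' a b) + map_poly (dact smul') (cbr' a b)"
        by (simp_all add: hom sesquilinearD(3,4)[OF ses] map_d map_poly_add map_poly_lam \<phi>(1)
            additive.minus[OF additive_map_poly] flip: \<phi>_d)
    qed
    fix a b c
    obtain x y z where xyz: "a = \<phi> x" "b = \<phi> y" "c = \<phi> z" using ex by metis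
    have "map_poly \<phi> (cbr x y) = - reflect (dact smul') (map_poly \<phi> (cbr y x))"
      by (subst skew)
        (simp add: additive.minus[OF additive_map_poly[OF \<phi>(1)]] \<phi>(1) d \<phi>_d
          reflect_map_poly[of \<phi> "dact smul" "dact smul'"])
    then show "cbr' a b = - reflect (dact smul') (cbr' b a)"
      by (simp add: xyz hom)
    show "jacobiator cbr' a b c = 0"
      unfolding xyz
      by (subst jacobiator_transport[OF \<phi>(1) sesquilinearD(1)[OF ses] sesquilinearD(2)[OF ses] add hom])
        (simp add: jac)
  qed
qed

lemma lie_conformal_iso:
  assumes mod: "module smul" "module smul'"
    and \<phi>: "additive \<phi>" "\<And>p x. \<phi> (smul p x) = smul' p (\<phi> x)" "bij \<phi>"
    and hom: "\<And>x y. cbr' (\<phi> x) (\<phi> y) = map_poly \<phi> (cbr x y)"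
  shows "lie_conformal_algebra smul cbr \<longleftrightarrow> lie_conformal_algebra smul' cbr'"
proof
  assume "lie_conformal_algebra smul cbr"
  then show "lie_conformal_algebra smul' cbr'"
    by (rule lie_conformal_transport[OF _ mod(2) \<phi>(1)])
      (rule \<phi>(2) bij_is_surj[OF \<phi>(3)] hom)+
next
  assume L: "lie_conformal_algebra smul' cbr'"
  let ?\<psi> = "inv \<phi>"
  have \<psi>\<phi>: "?\<psi> (\<phi> x) = x" and \<phi>\<psi>: "\<phi> (?\<psi> y) = y" for x y
    using \<phi>(3) by (simp_all add: bij_is_inj bij_is_surj surj_f_inv_f)
  have \<psi>: "additive ?\<psi>"
    unfolding additive_def by (metis \<phi>\<psi> \<psi>\<phi> additive.add[OF \<phi>(1)])
  have retract: "map_poly ?\<psi> (map_poly \<phi> p) = p" for p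
    by (simp add: map_poly_map_poly additive.zero \<psi> \<phi>(1) o_def \<psi>\<phi>)
  show "lie_conformal_algebra smul cbr"
  proof (rule lie_conformal_transport[OF L mod(1) \<psi>])
    show "?\<psi> (smul' p x) = smul p (?\<psi> x)" for p x
      by (metis \<phi>(2) \<phi>\<psi> \<psi>\<phi>)
    show "surj ?\<psi>"
      using \<phi>(3) by (simp add: bij_imp_bij_inv bij_is_surj)
    show "cbr (?\<psi> x) (?\<psi> y) = map_poly ?\<psi> (cbr' x y)" for x y
      using hom[of "?\<psi> x" "?\<psi> y"] by (simp add: \<phi>\<psi> retract)
  qed
qed

section \<open>Direct sums\<close>

text \<open>The isomorphism \<open>k[\<partial>](A \<oplus> B) \<cong> k[\<partial>]A \<oplus> k[\<partial>]B\<close>.\<close>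

definition split_poly :: "('a::ab_group_add \<times> 'b::ab_group_add) poly \<Rightarrow> 'a poly \<times> 'b poly" where
  "split_poly P = (map_poly fst P, map_poly snd P)"

lemma additive_projections:
  "additive (fst :: 'a::ab_group_add \<times> 'b::ab_group_add \<Rightarrow> 'a)"
  "additive (snd :: 'a::ab_group_add \<times> 'b::ab_group_add \<Rightarrow> 'b)"
  "additive (\<lambda>r. (r, 0) :: 'a::ab_group_add \<times> 'b::ab_group_add)"
  "additive (\<lambda>s. (0, s) :: 'a::ab_group_add \<times> 'b::ab_group_add)"
  by (simp_all add: additive_def)

lemma additive_split_poly: "additive split_poly"
  by (simp add: additive_def split_poly_def map_poly_add additive_projections)

lemma split_poly_pCons:
  "split_poly (pCons (a, x) P) = (pCons a (fst (split_poly P)), pCons x (snd (split_poly P)))"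
  by (simp add: split_poly_def map_poly_pCons)

lemma split_poly_pair_poly: "split_poly (pair_poly p q) = (p, q)"
  by (simp add: split_poly_def pair_poly_def map_poly_add additive_projections map_poly_map_poly
      o_def poly_eq_iff coeff_map_poly zero_prod_def[symmetric])

lemma bij_split_poly: "bij split_poly"
proof (rule bijI)
  show "inj split_poly"
    by (rule injI) (simp add: split_poly_def poly_eq_iff coeff_map_poly prod_eq_iff)
  show "surj split_poly"
    by (rule surjI[of _ "\<lambda>(p, q). pair_poly p q"]) (auto simp: split_poly_pair_poly)
qed

lemma free_smul_map_poly:
  assumes h: "additive h" "\<And>c x. h (s c x) = t c (h x)" and s: "vector_space s" and t: "vector_space t"
  shows "map_poly h (free_smul s p f) = free_smul t p (map_poly h f)"
proof -
  interpret S: vector_space "\<lambda>c. map_poly (s c)" by (rule vector_space_map_poly[OF s])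
  have "map_poly h (map_poly (s c) f) = map_poly (t c) (map_poly h f)" for c
    using assms by (simp add: map_poly_map_poly additive.zero additive_scale o_def)
  then show ?thesis
    unfolding free_smul_def
    by (simp add: poly_subst_intertwine[OF additive_pCons additive_pCons additive_map_poly[OF h(1)]]
        map_poly_pCons_0 h(1))
qed

lemma module_prod_scale:
  "module s \<Longrightarrow> module t \<Longrightarrow> module_prod.scale s t c (x, y) = (s c x, t c y)"
  by (simp add: module_prod.scale_prod module_prod_def module_pair_def)

lemma module_prod_module: "module s \<Longrightarrow> module t \<Longrightarrow> module (module_prod.scale s t)"
  unfolding module_def by (auto simp: module_prod_scale module_def)

text \<open>The brackets on both sides are sesquilinear in \<open>X\<close> and \<open>Y\<close> with values in
  \<open>(k[\<partial>]A \<oplus> k[\<partial>]B)[\<lambda>]\<close>, and their agreement on generators is the definition of the products of the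
  direct sum, once \<open>\<lambda> \<mapsto> -\<lambda> - \<partial>\<close> has been carried out in the mixed terms.\<close>

lemma lc_sum_br_split_poly:
  fixes sA :: "'k::field_char_0 \<Rightarrow> 'a::ab_group_add \<Rightarrow> 'a" and sB :: "'k \<Rightarrow> 'b::ab_group_add \<Rightarrow> 'b"
  defines "sP \<equiv> module_prod.scale sA sB"
  assumes A: "vector_space sA" and B: "vector_space sB"
    and circA: "bilinear_map sA sA sA circA" and brA: "bilinear_map sA sA sA brA"
    and circB: "bilinear_map sB sB sB circB" and brB: "bilinear_map sB sB sB brB"
    and lA: "bilinear_map sA sB sB lA" and rA: "bilinear_map sA sB sB rA"
    and rhoA: "bilinear_map sA sB sB rhoA"
    and lB: "bilinear_map sB sA sA lB" and rB: "bilinear_map sB sA sA rB"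
    and rhoB: "bilinear_map sB sA sA rhoB"
    and P: "vector_space sP"
    and circP: "bilinear_map sP sP sP (gd_sum_circ circA circB lA rA lB rB)"
    and brP: "bilinear_map sP sP sP (gd_sum_br brA brB rhoA rhoB)"
  shows "lc_sum_br (free_smul sA) (gd_cbr circA brA) (free_smul sB) (gd_cbr circB brB)
      (gd_rep lA rA rhoA) (gd_rep lB rB rhoB) (split_poly X) (split_poly Y) =
    map_poly split_poly
      (gd_cbr (gd_sum_circ circA circB lA rA lB rB) (gd_sum_br brA brB rhoA rhoB) X Y)"
proof -
  let ?d = "map_prod (pCons 0) (pCons 0) :: 'a poly \<times> 'b poly \<Rightarrow> _"
  let ?F = "gd_cbr (gd_sum_circ circA circB lA rA lB rB) (gd_sum_br brA brB rhoA rhoB)"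
  note proj = additive_projections[THEN additive_map_poly]
  note sesA = sesquilinear_gd_cbr[OF A circA brA] and constA = gd_cbr_const[OF A circA brA]
  note sesB = sesquilinear_gd_cbr[OF B circB brB] and constB = gd_cbr_const[OF B circB brB]
  note sesAB = sesquilinear_gd_rep[OF A B lA rA rhoA] and constAB = gd_rep_const[OF A B lA rA rhoA]
  note sesBA = sesquilinear_gd_rep[OF B A lB rB rhoB] and constBA = gd_rep_const[OF B A lB rB rhoB]
  note sesP = sesquilinear_gd_cbr[OF P circP brP] and constP = gd_cbr_const[OF P circP brP]
  note swapAB = sesquilinear_swap[OF sesAB additive_pCons]
    and swapBA = sesquilinear_swap[OF sesBA additive_pCons]
  \<comment> \<open>The components of the bracket in \<open>k[\<partial>]A\<close> and \<open>k[\<partial>]B\<close>.\<close>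
  define E where "E X Y = gd_cbr circA brA (map_poly fst X) (map_poly fst Y)
      + gd_rep lB rB rhoB (map_poly snd X) (map_poly fst Y)
      + (- reflect (pCons 0) (gd_rep lB rB rhoB (map_poly snd Y) (map_poly fst X)))"
    for X Y :: "('a \<times> 'b) poly"
  define F where "F X Y = gd_cbr circB brB (map_poly snd X) (map_poly snd Y)
      + gd_rep lA rA rhoA (map_poly fst X) (map_poly snd Y)
      + (- reflect (pCons 0) (gd_rep lA rA rhoA (map_poly fst Y) (map_poly snd X)))"
    for X Y :: "('a \<times> 'b) poly"
  have d: "additive ?d" by (simp add: additive_def)
  have restrict: "sesquilinear (pCons 0) (pCons 0) (pCons 0) (\<lambda>X Y. f (map_poly g X) (map_poly h Y))"
    if "sesquilinear (pCons 0) (pCons 0) (pCons 0) f" "additive g" "additive h"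
    for f :: "'u::ab_group_add poly \<Rightarrow> 'v::ab_group_add poly \<Rightarrow> 'w::ab_group_add poly poly"
      and g :: "'a \<times> 'b \<Rightarrow> 'u" and h :: "'a \<times> 'b \<Rightarrow> 'v"
    using sesquilinear_comp[OF that(1), where g = "map_poly g" and h = "map_poly h" and k = "\<lambda>x. x"
        and dR' = "pCons 0" and dS' = "pCons 0" and dM' = "pCons 0"] that
    by (auto simp: map_poly_pCons_0 additive_map_poly additive_pCons intro: additive.intro)
  have E: "sesquilinear (pCons 0) (pCons 0) (pCons 0) E"
    unfolding E_def[abs_def]
    by (intro sesquilinear_add additive_pCons restrict[OF sesA] restrict[OF sesBA]
        restrict[OF swapBA] additive_projections)
  have F: "sesquilinear (pCons 0) (pCons 0) (pCons 0) F"
    unfolding F_def[abs_def]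
    by (intro sesquilinear_add additive_pCons restrict[OF sesB] restrict[OF sesAB]
        restrict[OF swapAB] additive_projections)
  have sum: "lc_sum_br (free_smul sA) (gd_cbr circA brA) (free_smul sB) (gd_cbr circB brB)
      (gd_rep lA rA rhoA) (gd_rep lB rB rhoB) (split_poly X) (split_poly Y) =
      map_poly (\<lambda>r. (r, 0)) (E X Y) + map_poly (\<lambda>s. (0, s)) (F X Y)" for X Y
    by (simp add: split_poly_def pair_poly_def E_def F_def neg_lam_d_def reflect_def dact_poly_def
        dact_free_smul A B)
  have left: "sesquilinear (pCons 0) (pCons 0) ?d
      (\<lambda>X Y. map_poly (\<lambda>r. (r, 0)) (E X Y) + map_poly (\<lambda>s. (0, s)) (F X Y))"
    using sesquilinear_comp[OF E, where g = "\<lambda>x. x" and h = "\<lambda>x. x" and k = "\<lambda>r. (r, 0)"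
        and dR' = "pCons 0" and dS' = "pCons 0" and dM' = "?d"]
      sesquilinear_comp[OF F, where g = "\<lambda>x. x" and h = "\<lambda>x. x" and k = "\<lambda>s. (0, s)"
        and dR' = "pCons 0" and dS' = "pCons 0" and dM' = "?d"]
    by (intro sesquilinear_add d) (auto simp: additive_pCons d additive_projections intro: additive.intro)
  have right: "sesquilinear (pCons 0) (pCons 0) ?d (\<lambda>X Y. map_poly split_poly (?F X Y))"
    using sesquilinear_comp[OF sesP, where g = "\<lambda>x. x" and h = "\<lambda>x. x" and k = split_poly
        and dR' = "pCons 0" and dS' = "pCons 0" and dM' = "?d"]
    by (auto simp: additive_pCons d additive_split_poly split_poly_def map_poly_pCons_0
        additive_projections intro: additive.intro)
  have "map_poly (\<lambda>r. (r, 0)) (E [:u:] [:v:]) + map_poly (\<lambda>s. (0, s)) (F [:u:] [:v:]) =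
      map_poly split_poly (?F [:u:] [:v:])" for u v
  proof -
    obtain a x b y where uv: "u = (a, x)" "v = (b, y)" by (metis surj_pair)
    have split0: "split_poly 0 = 0"
      by (rule additive.zero[OF additive_split_poly])
    show ?thesis
      unfolding uv constP
      by (simp add: E_def F_def map_poly_pCons constA constB constAB constBA reflect_generator
          split_poly_pCons split0 zero_prod_def)
  qed
  then show ?thesis
    unfolding sum by (rule sesquilinear_unique[OF left right])
qed

lemma
  fixes sA :: "'k::field_char_0 \<Rightarrow> 'a::ab_group_add \<Rightarrow> 'a" and sB :: "'k \<Rightarrow> 'b::ab_group_add \<Rightarrow> 'b"
  defines "sP \<equiv> module_prod.scale sA sB"
  assumes A: "vector_space sA" and B: "vector_space sB"
  shows vector_space_prod_scale: "vector_space sP"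
    and bilinear_gd_sum_circ: "bilinear_map sA sA sA circA \<Longrightarrow> bilinear_map sB sB sB circB \<Longrightarrow>
      bilinear_map sA sB sB lA \<Longrightarrow> bilinear_map sA sB sB rA \<Longrightarrow> bilinear_map sB sA sA lB \<Longrightarrow>
      bilinear_map sB sA sA rB \<Longrightarrow> bilinear_map sP sP sP (gd_sum_circ circA circB lA rA lB rB)"
    and bilinear_gd_sum_br: "bilinear_map sA sA sA brA \<Longrightarrow> bilinear_map sB sB sB brB \<Longrightarrow>
      bilinear_map sA sB sB rhoA \<Longrightarrow> bilinear_map sB sA sA rhoB \<Longrightarrow>
      bilinear_map sP sP sP (gd_sum_br brA brB rhoA rhoB)"
proof -
  note mod = A[unfolded module_iff_vector_space[symmetric]] B[unfolded module_iff_vector_space[symmetric]]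
  show P: "vector_space sP"
    using module_prod_module[OF mod] by (simp add: sP_def module_iff_vector_space)
  have scale: "sP c (x, y) = (sA c x, sB c y)" for c x y
    by (simp add: sP_def module_prod_scale mod)
  note sA = additive_scale[OF A] and sB = additive_scale[OF B]
  note s_lin = additive.add[OF sA] additive.diff[OF sA] additive.add[OF sB] additive.diff[OF sB]
  have rules: "f (x + x') y = f x y + f x' y" "f x (y + y') = f x y + f x y'"
    "f (s c x) y = u c (f x y)" "f x (t c y) = u c (f x y)"
    if "bilinear_map s t u f" for s t u f c x x' y y'
    using bilinear_map_additive[OF that] bilinear_map_scale[OF that] by (auto simp: additive_def)
  show "bilinear_map sP sP sP (gd_sum_circ circA circB lA rA lB rB)"
    if "bilinear_map sA sA sA circA" "bilinear_map sB sB sB circB"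
      "bilinear_map sA sB sB lA" "bilinear_map sA sB sB rA" "bilinear_map sB sA sA lB"
      "bilinear_map sB sA sA rB"
    by (rule bilinear_mapI[OF P P P])
      (auto simp: additive_def split_paired_all scale s_lin that[THEN rules(1)] that[THEN rules(2)]
        that[THEN rules(3)] that[THEN rules(4)] algebra_simps)
  show "bilinear_map sP sP sP (gd_sum_br brA brB rhoA rhoB)"
    if "bilinear_map sA sA sA brA" "bilinear_map sB sB sB brB"
      "bilinear_map sA sB sB rhoA" "bilinear_map sB sA sA rhoB"
    by (rule bilinear_mapI[OF P P P])
      (auto simp: additive_def split_paired_all scale s_lin that[THEN rules(1)] that[THEN rules(2)]
        that[THEN rules(3)] that[THEN rules(4)] algebra_simps)
qed

theorem proposition4p13:
  fixes sA :: "'k::field_char_0 \<Rightarrow> 'a::ab_group_add \<Rightarrow> 'a"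
    and sB :: "'k \<Rightarrow> 'b::ab_group_add \<Rightarrow> 'b"
    and circA brA :: "'a \<Rightarrow> 'a \<Rightarrow> 'a"
    and circB brB :: "'b \<Rightarrow> 'b \<Rightarrow> 'b"
    and lA rA rhoA :: "'a \<Rightarrow> 'b \<Rightarrow> 'b"
    and lB rB rhoB :: "'b \<Rightarrow> 'a \<Rightarrow> 'a"
  assumes "finite_dimensional_vector_space sA basisA"
    and "finite_dimensional_vector_space sB basisB"
    and "gd_algebra sA circA brA"
    and "gd_algebra sB circB brB"
    and "linear_into_End sA sB lA" "linear_into_End sA sB rA" "linear_into_End sA sB rhoA"
    and "linear_into_End sB sA lB" "linear_into_End sB sA rB" "linear_into_End sB sA rhoB"
  shows "matched_pair_lc (free_smul sA) (gd_cbr circA brA) (free_smul sB) (gd_cbr circB brB)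
           (gd_rep lA rA rhoA) (gd_rep lB rB rhoB)
         \<longleftrightarrow> matched_pair_gd sA circA brA sB circB brB lA rA rhoA lB rB rhoB"
proof -
  interpret A: gd_algebra sA circA brA by fact
  interpret B: gd_algebra sB circB brB by fact
  let ?sP = "module_prod.scale sA sB"
  let ?circ = "gd_sum_circ circA circB lA rA lB rB" and ?br = "gd_sum_br brA brB rhoA rhoB"
  let ?sum = "module_prod.scale (free_smul sA) (free_smul sB)"
  note A = A.vector_space_axioms and B = B.vector_space_axioms
  note bilA = A.circ_bilinear A.br_bilinear and bilB = B.circ_bilinear B.br_bilinear
  note bilAB = assms(5-7)[THEN linear_into_End_bilinear, OF A B]
  note bilBA = assms(8-10)[THEN linear_into_End_bilinear, OF B A]
  note P = vector_space_prod_scale[OF A B]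
  have circP: "bilinear_map ?sP ?sP ?sP ?circ"
    by (intro bilinear_gd_sum_circ A B bilA bilB bilAB bilBA)
  have brP: "bilinear_map ?sP ?sP ?sP ?br"
    by (intro bilinear_gd_sum_br A B bilA bilB bilAB bilBA)
  note free = module_free_smul[OF A] module_free_smul[OF B]
  have scale: "?sP c x = (sA c (fst x), sB c (snd x))" for c x
    by (cases x) (simp add: module_prod_scale module_iff_vector_space A B)
  have split: "split_poly (free_smul ?sP p X) = ?sum p (split_poly X)" for p X
    by (simp add: split_poly_def module_prod_scale free
        free_smul_map_poly[where s = ?sP, OF additive_projections(1) _ P A]
        free_smul_map_poly[where s = ?sP, OF additive_projections(2) _ P B] scale)
  have sum: "lie_conformal_algebra ?sum (lc_sum_br (free_smul sA) (gd_cbr circA brA) (free_smul sB)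
        (gd_cbr circB brB) (gd_rep lA rA rhoA) (gd_rep lB rB rhoB)) \<longleftrightarrow>
      gd_algebra ?sP ?circ ?br"
  proof -
    have "lie_conformal_algebra (free_smul ?sP) (gd_cbr ?circ ?br) \<longleftrightarrow>
        lie_conformal_algebra ?sum (lc_sum_br (free_smul sA) (gd_cbr circA brA) (free_smul sB)
          (gd_cbr circB brB) (gd_rep lA rA rhoA) (gd_rep lB rB rhoB))"
      by (rule lie_conformal_iso[OF module_free_smul[OF P] module_prod_module[OF free]
            additive_split_poly split bij_split_poly])
        (rule lc_sum_br_split_poly[OF A B bilA bilB bilAB bilBA P circP brP])
    then show ?thesis
      by (simp add: lie_conformal_gd_iff[OF P circP brP])
  qed
  have hom: "gc_module_hom (free_smul sA) (free_smul sB) (gd_rep lA rA rhoA)"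
    "gc_module_hom (free_smul sB) (free_smul sA) (gd_rep lB rB rhoB)"
    using sesquilinear_gd_rep[OF A B bilAB] sesquilinear_gd_rep[OF B A bilBA]
    by (auto intro!: gc_module_hom_sesquilinear free bilinear_gd_rep A B bilAB bilBA
        simp: dact_free_smul A B)
  show ?thesis
    using assms sum hom lie_conformal_gd_iff[OF A bilA] lie_conformal_gd_iff[OF B bilB]
    by (simp add: matched_pair_lc_def matched_pair_gd_def)
qed

end
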